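(* Let $(X,e)$ be a coalgebra for $F=M\otimes -$ on the category $\mathbf{Met}_3^{C}$ of tri-pointed metric spaces and continuous maps preserving the distinguished points (i.e. $e:X\to M\otimes X$ is continuous and preserves distinguished points). Let $(S,\psi)$ be the $F$-coalgebra obtained by Cauchy completing the initial algebra $(G,g)$ of $F$ on tri-pointed sets. Then the mediating morphism $f:X\to S$, $f(x)=\lim_{k\to\infty}\theta_k(x)$, which is the unique distinguished-point-preserving function with $(M\otimes f)\circ e=\psi\circ f$, is continuous.
   Context: A tri-pointed set is a set $X$ with three distinguished elements $T,L,R$ (written $T_X,L_X,R_X$). $\mathbf{Set}_3$ is the category of tri-pointed sets and functions preserving $T,L,R$. A tri-pointed metric space is a tri-pointed set with a metric $d$ satisfying $d(x,y)\le 1$ for all $x,y$ and such that any two different ones of the distinguished elements are at distance exactly $1$. Let $M=\{a,b,c\}$. For a tri-pointed set $X$, $M\otimes X$ is the quotient of $M\times X$ by the equivalence relation generated by $(b,T)\sim(a,L)$, $(a,R)\sim(c,T)$, $(c,L)\sim(b,R)$; the class of $(m,x)$ is written $m\otimes x$. Its distinguished elements are $T_{M\otimes X}=a\otimes T$, $L_{M\otimes X}=b\otimes L$, $R_{M\otimes X}=c\otimes R$. If $X$ is a tri-pointed metric space, $M\times X$ has the metric $d((m,x),(n,y))=\frac12 d(x,y)$ if $m=n$ and $1$ if $m\ne n$, and $M\otimes X$ has the quotient metric, which is explicitly: $d(m\otimes x,m\otimes y)=\frac12 d(x,y)$; $d(a\otimes x,b\otimes y)=\frac12\min\{d(x,L)+d(T,y),\,d(x,R)+1+d(R,y)\}$;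 $d(a\otimes x,c\otimes y)=\frac12\min\{d(x,R)+d(T,y),\,d(x,L)+1+d(L,y)\}$; $d(b\otimes x,c\otimes y)=\frac12\min\{d(x,R)+d(L,y),\,d(x,T)+1+d(T,y)\}$. This is again a tri-pointed metric space. The functor $F=M\otimes -$ acts on morphisms by $(M\otimes f)(m\otimes x)=m\otimes f(x)$; $M^n\otimes -$ is its $n$-fold iterate, with elements $m_1\otimes\cdots\otimes m_n\otimes x$. Let $I=\{T,L,R\}$ with the discrete metric, and $!:I\to M\otimes I$ the map $T\mapsto a\otimes T$, $L\mapsto b\otimes L$, $R\mapsto c\otimes R$. $G$ is the colimit of $I\xrightarrow{!}M\otimes I\xrightarrow{M\otimes !}M^2\otimes I\to\cdots$, i.e. the quotient of the disjoint union of the $M^n\otimes I$ identifying each element with its images along the chain; $[\chi]$ is the class of $\chi$. Distinguished points of $G$: $[T],[L],[R]$. All chain maps are isometric embeddings, and the canonical metric of $G$ is $d_G([\chi],[\chi'])=d(\tilde\chi,\tilde\chi')$, where $\tilde\chi,\tilde\chi'$ are images of $\chi,\chi'$ in a common $M^p\otimes I$. The map $g:M\otimes G\to G$, $g(m\otimes[x])=[m\otimes x]$, is an isometric isomorphism and $(G,g)$ is the initial $F$-algebra on $\mathbf{Set}_3$. $S$ is the Cauchy completion of $G$ (equivalence classes $[x_n]$ of Cauchy sequences $(x_n)$ in $G$), with distinguished points those of $G$; $s:M\otimes S\to S$ is the isometric isomorphism $s(m\otimes[x_n])=[g(m\otimes x_n)]$, and $\psi=s^{-1}$. $G$ is regarded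 as a dense subset of $S$. The sequence $\theta_n(x)$: given a coalgebra $e:X\to M\otimes X$ in $\mathbf{Set}_3$ and $x\in X$, choose inductively $x_0=x$ and, for $n\ge1$, $m_n\in M$ and $x_n\in X$ with $e(x_{n-1})=m_n\otimes x_n$. Put $\theta_n(x)=[m_1\otimes\cdots\otimes m_n\otimes\overline{x_n}]\in G$, where $\overline{x_n}\in I$ is $T$, $L$ or $R$ according as $m_n$ is $a$, $b$ or $c$. The sequence $(\theta_n(x))_n$ is Cauchy in $G$. The representatives may be chosen arbitrarily for each $x$. *)

theory Defs
  imports "HOL-Analysis.Analysis" "HOL-Library.FSet"
begin

section \<open>Tri-pointed metric spaces\<close>

record 'a tripointed =
  pts :: "'a set"
  topp :: 'a
  leftp :: 'a
  rightp :: 'a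

record 'a trimetric = "'a tripointed" +
  dst :: "'a \<Rightarrow> 'a \<Rightarrow> real"

definition tripointed_set :: "('a, 'z) tripointed_scheme \<Rightarrow> bool" where
  "tripointed_set X \<longleftrightarrow> topp X \<in> pts X \<and> leftp X \<in> pts X \<and> rightp X \<in> pts X"

definition tripointed_metric_space :: "'a trimetric \<Rightarrow> bool" where
  "tripointed_metric_space X \<longleftrightarrow>
     tripointed_set X \<and> Metric_space (pts X) (dst X) \<and>
     (\<forall>x\<in>pts X. \<forall>y\<in>pts X. dst X x y \<le> 1) \<and>
     dst X (topp X) (leftp X) = 1 \<and>
     dst X (topp X) (rightp X) = 1 \<and>
     dst X (leftp X) (rightp X) = 1"

definition tri_hom ::
  "('a, 'y) tripointed_scheme \<Rightarrow> ('b, 'z) tripointed_scheme \<Rightarrow> ('a \<Rightarrow> 'b) \<Rightarrow> bool" where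
  "tri_hom X Y f \<longleftrightarrow>
     f \<in> pts X \<rightarrow> pts Y \<and>
     f (topp X) = topp Y \<and> f (leftp X) = leftp Y \<and> f (rightp X) = rightp Y"

abbreviation mtop :: "'a trimetric \<Rightarrow> 'a topology" where
  "mtop X \<equiv> Metric_space.mtopology (pts X) (dst X)"

text \<open>The library's locale \<^locale>\<open>Metric_space\<close> asks for symmetry and nonnegativity of the distance
  on the whole type. Distances on quotients are therefore set to \<open>0\<close> off the carrier.\<close>

definition dist_on :: "'a set \<Rightarrow> ('a \<Rightarrow> 'a \<Rightarrow> real) \<Rightarrow> 'a \<Rightarrow> 'a \<Rightarrow> real" where
  "dist_on A d x y = (if x \<in> A \<and> y \<in> A then d x y else 0)"

text \<open>The equivalence relation on \<open>A\<close> generated by a relation \<open>r\<close> between elements of \<open>A\<close>.\<close>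

definition gen_equiv :: "'a set \<Rightarrow> ('a \<Rightarrow> 'a \<Rightarrow> bool) \<Rightarrow> 'a rel" where
  "gen_equiv A r = {(p, q). p \<in> A \<and> q \<in> A \<and> equivclp r p q}"


section \<open>The functor\<close>

datatype mon = Ma | Mb | Mc

inductive glue :: "('a, 'z) tripointed_scheme \<Rightarrow> mon \<times> 'a \<Rightarrow> mon \<times> 'a \<Rightarrow> bool"
  for X where
  "glue X (Mb, topp X) (Ma, leftp X)"
| "glue X (Ma, rightp X) (Mc, topp X)"
| "glue X (Mc, leftp X) (Mb, rightp X)"

definition tens_equiv :: "('a, 'z) tripointed_scheme \<Rightarrow> (mon \<times> 'a) rel" where
  "tens_equiv X = gen_equiv (UNIV \<times> pts X) (glue X)"

definition tens :: "('a, 'z) tripointed_scheme \<Rightarrow> mon \<Rightarrow> 'a \<Rightarrow> (mon \<times> 'a) set" where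
  "tens X m x = tens_equiv X `` {(m, x)}"

text \<open>The explicit formula for the quotient metric, in terms of representatives.\<close>

fun rep_dist :: "'a trimetric \<Rightarrow> mon \<times> 'a \<Rightarrow> mon \<times> 'a \<Rightarrow> real" where
  "rep_dist X (Ma, x) (Ma, y) = dst X x y / 2"
| "rep_dist X (Mb, x) (Mb, y) = dst X x y / 2"
| "rep_dist X (Mc, x) (Mc, y) = dst X x y / 2"
| "rep_dist X (Ma, x) (Mb, y) =
     min (dst X x (leftp X) + dst X (topp X) y) (dst X x (rightp X) + 1 + dst X (rightp X) y) / 2"
| "rep_dist X (Mb, y) (Ma, x) =
     min (dst X x (leftp X) + dst X (topp X) y) (dst X x (rightp X) + 1 + dst X (rightp X) y) / 2"
| "rep_dist X (Ma, x) (Mc, y) =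
     min (dst X x (rightp X) + dst X (topp X) y) (dst X x (leftp X) + 1 + dst X (leftp X) y) / 2"
| "rep_dist X (Mc, y) (Ma, x) =
     min (dst X x (rightp X) + dst X (topp X) y) (dst X x (leftp X) + 1 + dst X (leftp X) y) / 2"
| "rep_dist X (Mb, x) (Mc, y) =
     min (dst X x (rightp X) + dst X (leftp X) y) (dst X x (topp X) + 1 + dst X (topp X) y) / 2"
| "rep_dist X (Mc, y) (Mb, x) =
     min (dst X x (rightp X) + dst X (leftp X) y) (dst X x (topp X) + 1 + dst X (topp X) y) / 2"

definition MT :: "'a trimetric \<Rightarrow> (mon \<times> 'a) set trimetric" where
  "MT X = \<lparr>pts = (UNIV \<times> pts X) // tens_equiv X,
           topp = tens X Ma (topp X),
           leftp = tens X Mb (leftp X),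
           rightp = tens X Mc (rightp X),
           dst = dist_on ((UNIV \<times> pts X) // tens_equiv X)
                   (\<lambda>C D. THE r. \<exists>p\<in>C. \<exists>q\<in>D. r = rep_dist X p q)\<rparr>"

text \<open>The action on a morphism \<open>f\<close> into \<open>Y\<close>: the class of \<open>(m, x)\<close> goes to the class of
  \<open>(m, f x)\<close> in the quotient of \<open>M \<times> Y\<close>.\<close>

definition MT_map :: "('b, 'z) tripointed_scheme \<Rightarrow> ('a \<Rightarrow> 'b) \<Rightarrow> (mon \<times> 'a) set \<Rightarrow> (mon \<times> 'b) set"
  where "MT_map Y f C = tens_equiv Y `` (map_prod id f ` C)"


section \<open>The iterates applied to the three-point space\<close>

datatype pt = PT | PL | PR

text \<open>The iterates of \<^const>\<open>MT\<close> live in different types. To form their disjoint union they are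
  transported to one type, in which \<open>Node\<close> names an equivalence class of pairs; all classes
  involved are finite (lemma \<open>decode_encode\<close> below).\<close>

datatype univ = Pt pt | Node "(mon \<times> univ) fset"

definition encode :: "(mon \<times> univ) set \<Rightarrow> univ" where
  "encode C = Node (Abs_fset C)"

primrec decode :: "univ \<Rightarrow> (mon \<times> univ) set" where
  "decode (Pt i) = {}"
| "decode (Node F) = fset F"

lemma finite_tens_class:
  assumes "C \<in> (UNIV \<times> pts X) // tens_equiv X"
  shows "finite C"
proof -
  obtain p where C: "C = tens_equiv X `` {p}"
    using assms by (auto elim: quotientE)
  let ?B = "insert p (UNIV \<times> {topp X, leftp X, rightp X})"
  have "q \<in> ?B" if "equivclp (glue X) p q" for q
    using that by (induction rule: equivclp_induct) (auto elim: glue.cases)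
  then have "C \<subseteq> ?B"
    by (auto simp: C tens_equiv_def gen_equiv_def)
  moreover have "finite (UNIV :: mon set)"
    by (rule finite_subset[of _ "{Ma, Mb, Mc}"]) (use mon.exhaust in auto)
  ultimately show ?thesis
    using finite_subset[of C ?B] by (simp add: finite_cartesian_product)
qed

lemma decode_encode:
  "C \<in> (UNIV \<times> pts X) // tens_equiv X \<Longrightarrow> decode (encode C) = C"
  by (simp add: encode_def Abs_fset_inverse finite_tens_class)

definition three :: "univ trimetric" where
  "three = \<lparr>pts = {Pt PT, Pt PL, Pt PR}, topp = Pt PT, leftp = Pt PL, rightp = Pt PR,
            dst = (\<lambda>x y. if x = y then 0 else 1)\<rparr>"

definition transport :: "(mon \<times> univ) set trimetric \<Rightarrow> univ trimetric" where
  "transport X = \<lparr>pts = encode ` pts X, topp = encode (topp X), leftp = encode (leftp X),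
                  rightp = encode (rightp X), dst = (\<lambda>x y. dst X (decode x) (decode y))\<rparr>"

primrec iter :: "nat \<Rightarrow> univ trimetric" where
  "iter 0 = three"
| "iter (Suc n) = transport (MT (iter n))"

fun bang :: "univ \<Rightarrow> univ" where
  "bang (Pt PT) = encode (tens three Ma (Pt PT))"
| "bang (Pt PL) = encode (tens three Mb (Pt PL))"
| "bang (Pt PR) = encode (tens three Mc (Pt PR))"
| "bang (Node F) = undefined"

primrec chain :: "nat \<Rightarrow> univ \<Rightarrow> univ" where
  "chain 0 = bang"
| "chain (Suc n) = encode \<circ> MT_map (iter (Suc n)) (chain n) \<circ> decode"

text \<open>The element \<open>m\<^sub>1 \<otimes> \<dots> \<otimes> m\<^sub>n \<otimes> i\<close> of the \<open>n\<close>-th iterate.\<close>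

primrec word :: "mon list \<Rightarrow> pt \<Rightarrow> univ" where
  "word [] i = Pt i"
| "word (m # ms) i = encode (tens (iter (length ms)) m (word ms i))"


section \<open>The initial algebra\<close>

inductive chain_step :: "nat \<times> univ \<Rightarrow> nat \<times> univ \<Rightarrow> bool" where
  "x \<in> pts (iter n) \<Longrightarrow> chain_step (n, x) (Suc n, chain n x)"

definition colim_equiv :: "(nat \<times> univ) rel" where
  "colim_equiv = gen_equiv (SIGMA n:UNIV. pts (iter n)) chain_step"

definition colim_class :: "nat \<Rightarrow> univ \<Rightarrow> (nat \<times> univ) set" where
  "colim_class n x = colim_equiv `` {(n, x)}"

definition G :: "(nat \<times> univ) set trimetric" where
  "G = \<lparr>pts = (SIGMA n:UNIV. pts (iter n)) // colim_equiv,
        topp = colim_class 0 (Pt PT),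
        leftp = colim_class 0 (Pt PL),
        rightp = colim_class 0 (Pt PR),
        dst = dist_on ((SIGMA n:UNIV. pts (iter n)) // colim_equiv)
                (\<lambda>P Q. THE r. \<exists>n x y. (n, x) \<in> P \<and> (n, y) \<in> Q \<and> r = dst (iter n) x y)\<rparr>"

definition g :: "(mon \<times> (nat \<times> univ) set) set \<Rightarrow> (nat \<times> univ) set" where
  "g C = (THE Q. \<exists>m P n x. (m, P) \<in> C \<and> (n, x) \<in> P \<and>
            Q = colim_class (Suc n) (encode (tens (iter n) m x)))"


section \<open>Its Cauchy completion\<close>

definition cauchy_seqs :: "'a trimetric \<Rightarrow> (nat \<Rightarrow> 'a) set" where
  "cauchy_seqs X = {\<sigma>. Metric_space.MCauchy (pts X) (dst X) \<sigma>}"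

definition cauchy_equiv :: "'a trimetric \<Rightarrow> (nat \<Rightarrow> 'a) rel" where
  "cauchy_equiv X = {(\<sigma>, \<tau>). \<sigma> \<in> cauchy_seqs X \<and> \<tau> \<in> cauchy_seqs X \<and>
                       (\<lambda>n. dst X (\<sigma> n) (\<tau> n)) \<longlonglongrightarrow> 0}"

definition cauchy_class :: "'a trimetric \<Rightarrow> (nat \<Rightarrow> 'a) \<Rightarrow> (nat \<Rightarrow> 'a) set" where
  "cauchy_class X \<sigma> = cauchy_equiv X `` {\<sigma>}"

definition incl :: "'a trimetric \<Rightarrow> 'a \<Rightarrow> (nat \<Rightarrow> 'a) set" where
  "incl X x = cauchy_class X (\<lambda>_. x)"

definition completion :: "'a trimetric \<Rightarrow> (nat \<Rightarrow> 'a) set trimetric" where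
  "completion X = \<lparr>pts = cauchy_seqs X // cauchy_equiv X,
                   topp = incl X (topp X),
                   leftp = incl X (leftp X),
                   rightp = incl X (rightp X),
                   dst = dist_on (cauchy_seqs X // cauchy_equiv X)
                           (\<lambda>P Q. THE r. \<exists>\<sigma>\<in>P. \<exists>\<tau>\<in>Q. (\<lambda>n. dst X (\<sigma> n) (\<tau> n)) \<longlonglongrightarrow> r)\<rparr>"

definition S :: "(nat \<Rightarrow> (nat \<times> univ) set) set trimetric" where
  "S = completion G"

definition s :: "(mon \<times> (nat \<Rightarrow> (nat \<times> univ) set) set) set \<Rightarrow> (nat \<Rightarrow> (nat \<times> univ) set) set" where
  "s C = (THE Q. \<exists>m P \<sigma>. (m, P) \<in> C \<and> \<sigma> \<in> P \<and>
            Q = cauchy_class G (\<lambda>n. g (tens G m (\<sigma> n))))"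

definition \<psi> :: "(nat \<Rightarrow> (nat \<times> univ) set) set \<Rightarrow> (mon \<times> (nat \<Rightarrow> (nat \<times> univ) set) set) set" where
  "\<psi> = inv_into (pts (MT S)) s"


section \<open>The mediating morphism\<close>

text \<open>\<open>\<mu>\<close> and \<open>\<xi>\<close> are admissible choices of the \<open>m\<^sub>n\<close> (for \<open>n \<ge> 1\<close>) and the \<open>x\<^sub>n\<close> (for \<open>n \<ge> 0\<close>)
  for the point \<open>x\<close>. The value \<open>\<mu> 0\<close> is unconstrained; it only enters \<open>\<theta> \<mu> 0\<close>, which has no
  meaning of its own and does not affect the limit.\<close>

definition unravels ::
  "('a, 'z) tripointed_scheme \<Rightarrow> ('a \<Rightarrow> (mon \<times> 'a) set) \<Rightarrow> 'a \<Rightarrow> (nat \<Rightarrow> mon) \<Rightarrow> (nat \<Rightarrow> 'a) \<Rightarrow> bool"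
  where
  "unravels X e x \<mu> \<xi> \<longleftrightarrow>
     \<xi> 0 = x \<and>
     (\<forall>n. \<xi> (Suc n) \<in> pts X \<and> e (\<xi> n) = tens X (\<mu> (Suc n)) (\<xi> (Suc n)))"

primrec corner :: "mon \<Rightarrow> pt" where
  "corner Ma = PT"
| "corner Mb = PL"
| "corner Mc = PR"

definition \<theta> :: "(nat \<Rightarrow> mon) \<Rightarrow> nat \<Rightarrow> (nat \<times> univ) set" where
  "\<theta> \<mu> n = colim_class n (word (map \<mu> [1..<Suc n]) (corner (\<mu> n)))"

text \<open>The limit in \<open>S\<close> of \<open>\<theta>\<^sub>k x\<close>, where \<open>\<mu> x\<close> is the choice made for the point \<open>x\<close>.\<close>

definition mediating :: "('a \<Rightarrow> nat \<Rightarrow> mon) \<Rightarrow> 'a \<Rightarrow> (nat \<Rightarrow> (nat \<times> univ) set) set" where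
  "mediating \<mu> x = (THE l. limitin (mtop S) (\<lambda>k. incl G (\<theta> (\<mu> x) k)) l sequentially)"

definition coalgebra_morphism_to_S ::
  "'a trimetric \<Rightarrow> ('a \<Rightarrow> (mon \<times> 'a) set) \<Rightarrow> ('a \<Rightarrow> (nat \<Rightarrow> (nat \<times> univ) set) set) \<Rightarrow> bool" where
  "coalgebra_morphism_to_S X e f \<longleftrightarrow>
     tri_hom X S f \<and> (\<forall>x\<in>pts X. MT_map S f (e x) = \<psi> (f x))"

end

theory Submission
  imports Defs
begin

text \<open>
  The map \<^term>\<open>s\<close> halves distances on each of the three copies of \<^term>\<open>S\<close>, and a coalgebra
  morphism \<open>f\<close> satisfies \<open>f x = s (m \<otimes> f y)\<close> for every representation \<open>e x = m \<otimes> y\<close>. Hence two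
  morphisms, or the limits belonging to two choices of representatives, differ by at most \<open>2\<^sup>-\<^sup>n\<close>
  for every \<open>n\<close>. For continuity at \<open>x\<close>, note that every point of \<open>M \<otimes> X\<close> close to \<open>e x\<close> shares a
  copy \<open>m\<close> with \<open>e x\<close>, and \<open>e x\<close> has only finitely many representatives \<open>(m, z)\<close>: an oscillation
  of at most \<open>2\<^sup>-\<^sup>n\<close> near each \<open>z\<close> gives one of at most \<open>2\<^sup>-\<^sup>n\<^sup>-\<^sup>1\<close> near \<open>x\<close>.

  The metrics on \<open>M \<otimes> X\<close>, on \<^term>\<open>G\<close> and on \<^term>\<open>S\<close> all arise by identifying the points at
  distance \<open>0\<close> in a pseudometric.
\<close>

section \<open>Quotients of pseudometrics\<close>

text \<open>The relation is a parameter, tied to distance \<open>0\<close> by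
  \<open>rel_iff\<close>, because each use brings its own definition: generated by the gluing,
  generated by the chain steps, or given by equivalence of Cauchy sequences.\<close>

locale pseudometric =
  fixes A :: "'a set" and D :: "'a \<Rightarrow> 'a \<Rightarrow> real" and R :: "'a rel"
  assumes nonneg: "p \<in> A \<Longrightarrow> q \<in> A \<Longrightarrow> 0 \<le> D p q"
    and self: "p \<in> A \<Longrightarrow> D p p = 0"
    and commute: "p \<in> A \<Longrightarrow> q \<in> A \<Longrightarrow> D p q = D q p"
    and triangle: "p \<in> A \<Longrightarrow> q \<in> A \<Longrightarrow> r \<in> A \<Longrightarrow> D p r \<le> D p q + D q r"
    and rel_iff: "(p, q) \<in> R \<longleftrightarrow> p \<in> A \<and> q \<in> A \<and> D p q = 0"
begin

lemma equiv_rel: "equiv A R"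
proof (rule equivI)
  show "R \<subseteq> A \<times> A" "refl_on A R" "sym R"
    by (auto simp: refl_on_def sym_def rel_iff self commute)
  show "trans R"
  proof (rule transI)
    fix p q r assume "(p, q) \<in> R" "(q, r) \<in> R"
    then show "(p, r) \<in> R"
      using triangle[of p q r] nonneg[of p r] by (auto simp: rel_iff)
  qed
qed

lemma class_eq_iff: "p \<in> A \<Longrightarrow> q \<in> A \<Longrightarrow> R `` {p} = R `` {q} \<longleftrightarrow> D p q = 0"
  using eq_equiv_class_iff[OF equiv_rel] rel_iff by metis

lemma dist_cong:
  assumes "(p, p') \<in> R" "(q, q') \<in> R"
  shows "D p' q' = D p q"
  using assms triangle[of p' p q] triangle[of p' q q'] triangle[of p p' q] triangle[of p' q' q]
  by (auto simp: rel_iff commute)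

text \<open>By \<open>dist_cong\<close> all pairs of representatives give the same value, so the
  definite description is meaningful.\<close>

lemma the_dist:
  assumes "p \<in> A" "q \<in> A"
  shows "(THE r. \<exists>p'\<in>R `` {p}. \<exists>q'\<in>R `` {q}. r = D p' q') = D p q"
proof (rule the_equality)
  show "\<exists>p'\<in>R `` {p}. \<exists>q'\<in>R `` {q}. D p q = D p' q'"
    using assms by (intro bexI[of _ p] bexI[of _ q]) (auto simp: rel_iff self)
qed (auto dest: dist_cong)

text \<open>The function \<open>d\<close> is only required to have the right values on classes,
  since the descriptions used for the three spaces differ in form. The value \<open>0\<close> off
  the carrier supplies nonnegativity and symmetry on the whole type.\<close>

lemma Metric_space_quotient:
  assumes d: "\<And>p q. p \<in> A \<Longrightarrow> q \<in> A \<Longrightarrow> d (R `` {p}) (R `` {q}) = D p q"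
  shows "Metric_space (A // R) (dist_on (A // R) d)"
proof
  show "0 \<le> dist_on (A // R) d P Q" for P Q
    by (auto simp: dist_on_def d nonneg elim!: quotientE)
  show "dist_on (A // R) d P Q = dist_on (A // R) d Q P" for P Q
    by (auto simp: dist_on_def d commute elim!: quotientE)
  show "(dist_on (A // R) d P Q = 0) = (P = Q)" if "P \<in> A // R" "Q \<in> A // R" for P Q
    using that by (elim quotientE) (simp add: dist_on_def d class_eq_iff quotientI)
  show "dist_on (A // R) d P Q \<le> dist_on (A // R) d P P' + dist_on (A // R) d P' Q"
    if "P \<in> A // R" "P' \<in> A // R" "Q \<in> A // R" for P P' Q
    using that by (auto simp: dist_on_def d triangle quotientI elim!: quotientE)
qed

end

text \<open>A generating step has distance \<open>0\<close>, and the triangle inequality extends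
  this to zigzags of steps. Together with the last hypothesis, the generated equivalence is exactly
  the relation of distance \<open>0\<close>.\<close>

lemma pseudometric_gen_equiv:
  assumes nonneg: "\<And>p q. p \<in> A \<Longrightarrow> q \<in> A \<Longrightarrow> 0 \<le> D p q"
    and self: "\<And>p. p \<in> A \<Longrightarrow> D p p = 0"
    and commute: "\<And>p q. p \<in> A \<Longrightarrow> q \<in> A \<Longrightarrow> D p q = D q p"
    and triangle: "\<And>p q r. p \<in> A \<Longrightarrow> q \<in> A \<Longrightarrow> r \<in> A \<Longrightarrow> D p r \<le> D p q + D q r"
    and gen: "\<And>p q. r p q \<Longrightarrow> p \<in> A \<and> q \<in> A \<and> D p q = 0"
    and equivclp: "\<And>p q. p \<in> A \<Longrightarrow> q \<in> A \<Longrightarrow> D p q = 0 \<Longrightarrow> equivclp r p q"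
  shows "pseudometric A D (gen_equiv A r)"
proof -
  have D_0: "q \<in> A \<and> D p q = 0" if "equivclp r p q" "p \<in> A" for p q
    using that(1)
  proof (induction rule: equivclp_induct)
    case base
    then show ?case using that self by simp
  next
    case (step y z)
    then have yz: "y \<in> A" "z \<in> A" "D p y = 0" "D y z = 0"
      using gen commute by metis+
    then have "D p z = 0"
      using triangle[of p y z] nonneg[of p z] that(2) by simp
    then show ?case
      using yz by simp
  qed
  show ?thesis
  proof (unfold_locales, goal_cases)
    case (5 p q)
    then show ?case
      using D_0 equivclp unfolding gen_equiv_def by blast
  qed (use assms in blast)+
qed

section \<open>The quotient metric on the tensor product\<close>

locale tripointed_metric =
  fixes X :: "'a trimetric"
  assumes tripointed_metric_space: "tripointed_metric_space X"
begin

lemma Metric_space_dst: "Metric_space (pts X) (dst X)"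
  using tripointed_metric_space by (simp add: tripointed_metric_space_def)

lemmas dst_nonneg [simp] = Metric_space.nonneg[OF Metric_space_dst]
  and dst_commute = Metric_space.commute[OF Metric_space_dst]
  and dst_zero = Metric_space.zero[OF Metric_space_dst]
  and dst_self = Metric_space.mdist_zero[OF Metric_space_dst]
  and dst_triangle = Metric_space.triangle[OF Metric_space_dst]

lemma corners_in [simp]: "topp X \<in> pts X" "leftp X \<in> pts X" "rightp X \<in> pts X"
  using tripointed_metric_space by (auto simp: tripointed_metric_space_def tripointed_set_def)

lemma dst_le_1: "x \<in> pts X \<Longrightarrow> y \<in> pts X \<Longrightarrow> dst X x y \<le> 1"
  using tripointed_metric_space by (auto simp: tripointed_metric_space_def)

lemma dst_corners [simp]:
  "dst X (topp X) (leftp X) = 1" "dst X (leftp X) (topp X) = 1"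
  "dst X (topp X) (rightp X) = 1" "dst X (rightp X) (topp X) = 1"
  "dst X (leftp X) (rightp X) = 1" "dst X (rightp X) (leftp X) = 1"
  "dst X (topp X) (topp X) = 0" "dst X (leftp X) (leftp X) = 0" "dst X (rightp X) (rightp X) = 0"
  using tripointed_metric_space dst_commute
  by (auto simp: tripointed_metric_space_def dst_self)

lemma rep_dist_nonneg [simp]: "0 \<le> rep_dist X p q"
  by (cases "(X, p, q)" rule: rep_dist.cases) auto

lemma rep_dist_commute: "rep_dist X p q = rep_dist X q p"
  by (cases "(X, p, q)" rule: rep_dist.cases) (auto simp: dst_commute)

lemma rep_dist_same: "rep_dist X (m, x) (m, y) = dst X x y / 2"
  by (cases m) auto

lemma rep_dist_triangle:
  assumes "x \<in> pts X" "y \<in> pts X" "z \<in> pts X"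
  shows "rep_dist X (m, x) (k, z) \<le> rep_dist X (m, x) (n, y) + rep_dist X (n, y) (k, z)"
proof -
  \<comment> \<open>Every \<open>rep_dist\<close> is built from distances among \<open>x\<close>,
    \<open>y\<close>, \<open>z\<close> and the corners, so the 27 cases are linear arithmetic over
    the facts collected here. The last family in \<open>tri\<close>, at two different corners,
    bounds from below the cost of crossing the copy of \<open>y\<close>. Where \<open>x\<close> and
    \<open>z\<close> share a copy and the two routes use different corners, the summand
    \<open>1\<close> of the detour already exceeds the distance to be bounded.\<close>
  let ?C = "{topp X, leftp X, rightp X}"
  have le: "dst X x y \<le> 1" "dst X x z \<le> 1" "dst X y z \<le> 1"
    "\<forall>u\<in>?C. dst X x u \<le> 1 \<and> dst X y u \<le> 1 \<and> dst X z u \<le> 1"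
    using assms dst_le_1 by auto
  have tri: "dst X x z \<le> dst X x y + dst X y z"
    "\<forall>u\<in>?C. dst X x u \<le> dst X x y + dst X y u \<and> dst X y u \<le> dst X x y + dst X x u"
    "\<forall>u\<in>?C. dst X y u \<le> dst X y z + dst X z u \<and> dst X z u \<le> dst X y z + dst X y u"
    "\<forall>u\<in>?C. dst X x z \<le> dst X x u + dst X z u"
    "\<forall>u\<in>?C. \<forall>v\<in>?C. dst X u v \<le> dst X y u + dst X y v"
    using assms dst_triangle dst_commute corners_in by (metis empty_iff insert_iff)+
  have nonneg: "\<forall>u\<in>?C. 0 \<le> dst X x u \<and> 0 \<le> dst X y u \<and> 0 \<le> dst X z u" "0 \<le> dst X x y" "0 \<le> dst X y z"
    by auto
  \<comment> \<open>As rewrite rules these equations put corners second and \<open>x\<close>,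
    \<open>y\<close>, \<open>z\<close> in order, so that facts and goals mention the same
    terms.\<close>
  have com: "dst X u v = dst X v u" if "u \<in> ?C" "v \<in> {x,y,z}" for u v
    by (rule dst_commute)
  have com': "dst X y x = dst X x y" "dst X z y = dst X y z" "dst X z x = dst X x z"
    by (rule dst_commute)+
  note ground = le[simplified] tri[simplified] nonneg[simplified]
  show ?thesis
    using ground
    by (cases m; cases n; cases k) (simp_all add: com com' min_def split del: if_split, (smt (z3))+)
qed

end

context tripointed_metric
begin

lemma glue_imp_rep_dist: "glue X p q \<Longrightarrow> rep_dist X p q = 0"
  by (auto elim!: glue.cases simp: min_def)

lemma glue_in: "glue X p q \<Longrightarrow> p \<in> UNIV \<times> pts X \<and> q \<in> UNIV \<times> pts X"
  by (auto elim!: glue.cases)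

text \<open>The detour contains the summand \<open>1\<close>, so across copies the minimum can
  vanish only along the direct route, and then both points are the glued corners.\<close>

lemma rep_dist_eq_0_cases:
  assumes "x \<in> pts X" "y \<in> pts X" "rep_dist X (m, x) (n, y) = 0"
  shows "(m, x) = (n, y) \<or> glue X (m, x) (n, y) \<or> glue X (n, y) (m, x)"
proof -
  have zero: "dst X u v = 0 \<longleftrightarrow> u = v" if "u \<in> pts X" "v \<in> pts X" for u v
    by (rule dst_zero[OF that])
  have sum_zero: "dst X u v + dst X u' v' = 0 \<longleftrightarrow> dst X u v = 0 \<and> dst X u' v' = 0" for u v u' v'
    by (simp add: add_nonneg_eq_0_iff)
  have pos: "dst X u v + 1 + dst X u' v' > 0" for u v u' v'
    by (simp add: add_nonneg_pos add_pos_nonneg)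
  have min_zero: "min a b = 0 \<longleftrightarrow> a = 0" if "b > 0" "a \<ge> 0" for a b :: real
    using that by (auto simp: min_def)
  show ?thesis
    using assms
    by (cases m; cases n) (auto simp: zero min_zero[OF pos] sum_zero glue.simps)
qed

sublocale rep: pseudometric "UNIV \<times> pts X" "rep_dist X" "tens_equiv X"
  unfolding tens_equiv_def
proof (rule pseudometric_gen_equiv, goal_cases)
  case (6 p q)
  then have "p = q \<or> glue X p q \<or> glue X q p"
    using rep_dist_eq_0_cases[of "snd p" "snd q" "fst p" "fst q"] by auto
  then show ?case
    by (metis equivclp_refl r_into_equivclp converse_r_into_equivclp)
next
  case (5 p q)
  then show ?case
    using glue_in glue_imp_rep_dist by blast
next
  case (4 p q r)
  then show ?case
    by (auto simp: rep_dist_triangle)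
next
  case (3 p q)
  show ?case
    by (rule rep_dist_commute)
qed (auto simp: rep_dist_same dst_self)

lemma pts_MT: "pts (MT X) = (UNIV \<times> pts X) // tens_equiv X"
  by (simp add: MT_def)

lemma tens_in [simp]: "x \<in> pts X \<Longrightarrow> tens X m x \<in> pts (MT X)"
  by (simp add: pts_MT tens_def quotientI)

lemma pts_MT_E:
  assumes "C \<in> pts (MT X)"
  obtains m x where "x \<in> pts X" "C = tens X m x"
  using assms by (auto simp: pts_MT tens_def elim!: quotientE)

lemma dst_MT:
  "x \<in> pts X \<Longrightarrow> y \<in> pts X \<Longrightarrow> dst (MT X) (tens X m x) (tens X n y) = rep_dist X (m, x) (n, y)"
  by (simp add: MT_def dist_on_def tens_def quotientI rep.the_dist)

lemma dst_MT_same: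
  "x \<in> pts X \<Longrightarrow> y \<in> pts X \<Longrightarrow> dst (MT X) (tens X m x) (tens X m y) = dst X x y / 2"
  by (simp add: dst_MT rep_dist_same)

lemma tens_eq_iff:
  "x \<in> pts X \<Longrightarrow> y \<in> pts X \<Longrightarrow> tens X m x = tens X n y \<longleftrightarrow> rep_dist X (m, x) (n, y) = 0"
  by (simp add: tens_def rep.class_eq_iff)

lemma tens_eq_D:
  "x \<in> pts X \<Longrightarrow> y \<in> pts X \<Longrightarrow> tens X m x = tens X n y \<Longrightarrow>
    (m, x) = (n, y) \<or> glue X (m, x) (n, y) \<or> glue X (n, y) (m, x)"
  using tens_eq_iff rep_dist_eq_0_cases by blast

lemma tens_glue:
  "tens X Mb (topp X) = tens X Ma (leftp X)"
  "tens X Ma (rightp X) = tens X Mc (topp X)"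
  "tens X Mc (leftp X) = tens X Mb (rightp X)"
  by (simp_all add: tens_eq_iff)

lemma in_tens_iff:
  assumes "x \<in> pts X"
  shows "(n, y) \<in> tens X m x \<longleftrightarrow> y \<in> pts X \<and> tens X n y = tens X m x"
proof -
  have "(n, y) \<in> tens X m x \<longleftrightarrow> y \<in> pts X \<and> rep_dist X (m, x) (n, y) = 0"
    using assms by (simp add: tens_def rep.rel_iff)
  then show ?thesis
    using assms tens_eq_iff by metis
qed

lemma corners_MT:
  "topp (MT X) = tens X Ma (topp X)" "leftp (MT X) = tens X Mb (leftp X)"
  "rightp (MT X) = tens X Mc (rightp X)"
  by (simp_all add: MT_def)

text \<open>Across copies the direct route, the first entry of the minimum, is a sum of two
  distances at most \<open>1\<close>, and the sum is halved.\<close>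

lemma rep_dist_le_1:
  assumes "x \<in> pts X" "y \<in> pts X"
  shows "rep_dist X (m, x) (n, y) \<le> 1"
proof -
  have "dst X u v \<le> 1" if "u \<in> {x, y, topp X, leftp X, rightp X}" "v \<in> {x, y, topp X, leftp X, rightp X}" for u v
    using that assms dst_le_1 by auto
  note le = this[simplified]
  have half: "min a b / 2 \<le> 1" if "a \<le> 2" for a b :: real
    using that by (auto simp: min_def)
  have sum: "dst X u v + dst X u' v' \<le> 2" if "dst X u v \<le> 1" "dst X u' v' \<le> 1" for u v u' v'
    using that by simp
  have self: "dst X u v / 2 \<le> 1" if "dst X u v \<le> 1" for u v
    using that by simp
  show ?thesis
    by (cases m; cases n; simp only: rep_dist.simps)
       (intro half sum self; simp add: le)+
qed

text \<open>Two corners of \<open>MT X\<close> lie in different copies and away from the gluing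
  points: the direct route between them has length \<open>2\<close> before halving and the detour
  \<open>3\<close>, so their distance is exactly \<open>1\<close>.\<close>

lemma tripointed_metric_MT: "tripointed_metric (MT X)"
proof
  have "Metric_space (pts (MT X)) (dst (MT X))"
  proof -
    have eq: "dst (MT X) = dist_on ((UNIV \<times> pts X) // tens_equiv X)
               (\<lambda>C D. THE r. \<exists>p\<in>C. \<exists>q\<in>D. r = rep_dist X p q)"
      by (simp add: MT_def)
    show ?thesis
      unfolding eq pts_MT by (rule rep.Metric_space_quotient) (rule rep.the_dist)
  qed
  moreover have "dst (MT X) C D \<le> 1" if "C \<in> pts (MT X)" "D \<in> pts (MT X)" for C D
    using that by (auto elim!: pts_MT_E simp: dst_MT rep_dist_le_1)
  ultimately show "tripointed_metric_space (MT X)"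
    by (simp add: tripointed_metric_space_def tripointed_set_def corners_MT dst_MT)
qed

end

section \<open>Isometric morphisms and the action of the functor\<close>

definition isometric_hom :: "'a trimetric \<Rightarrow> 'b trimetric \<Rightarrow> ('a \<Rightarrow> 'b) \<Rightarrow> bool" where
  "isometric_hom X Y f \<longleftrightarrow>
     tri_hom X Y f \<and> (\<forall>x\<in>pts X. \<forall>y\<in>pts X. dst Y (f x) (f y) = dst X x y)"

text \<open>\<open>rep_dist\<close> depends only on distances among the two points and the corners,
  all of which an isometric morphism preserves.\<close>

lemma rep_dist_isometric_hom:
  assumes "tripointed_metric X" "isometric_hom X Y f" "x \<in> pts X" "y \<in> pts X"
  shows "rep_dist Y (m, f x) (n, f y) = rep_dist X (m, x) (n, y)"
proof -
  interpret tripointed_metric X by fact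
  have "dst Y (f u) (f v) = dst X u v" if "u \<in> pts X" "v \<in> pts X" for u v
    using assms(2) that by (simp add: isometric_hom_def)
  moreover have "topp Y = f (topp X)" "leftp Y = f (leftp X)" "rightp Y = f (rightp X)"
    using assms(2) by (simp_all add: isometric_hom_def tri_hom_def)
  ultimately show ?thesis
    using assms(3,4) by (cases m; cases n) simp_all
qed

text \<open>This is the well-definedness of the functor on morphisms: glued representatives are
  corners, which \<open>f\<close> preserves, so their images are glued as well.\<close>

lemma MT_map_tens:
  assumes "tripointed_metric X" "tripointed_metric Y" "tri_hom X Y f" "x \<in> pts X"
  shows "MT_map Y f (tens X m x) = tens Y m (f x)"
proof -
  interpret X: tripointed_metric X by fact
  interpret Y: tripointed_metric Y by fact
  have f: "f u \<in> pts Y" if "u \<in> pts X" for u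
    using assms(3) that by (auto simp: tri_hom_def)
  have const: "tens Y n (f y) = tens Y m (f x)" if "(n, y) \<in> tens X m x" for n y
  proof -
    have "y \<in> pts X" "tens X n y = tens X m x"
      using that assms(4) by (auto simp: X.in_tens_iff)
    then have "(n, y) = (m, x) \<or> glue X (n, y) (m, x) \<or> glue X (m, x) (n, y)"
      using assms(4) X.tens_eq_D by blast
    then show ?thesis
      using assms(3) by (auto elim!: glue.cases simp: tri_hom_def Y.tens_glue)
  qed
  have self: "(m, x) \<in> tens X m x"
    using assms(4) by (simp add: X.in_tens_iff)
  \<comment> \<open>\<open>MT_map\<close> applies the relation to the whole image of a class, which
    gives a union of classes; by \<open>const\<close> all its members coincide.\<close>
  have "MT_map Y f C = (\<Union>p\<in>C. tens Y (fst p) (f (snd p)))" for C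
    unfolding MT_map_def tens_def map_prod_def by (auto simp: case_prod_beta)
  then show ?thesis
    using UN_constant_eq[OF self, of "\<lambda>p. tens Y (fst p) (f (snd p))"] const by simp
qed

lemma isometric_hom_MT_map:
  assumes "tripointed_metric X" "tripointed_metric Y" "isometric_hom X Y f"
  shows "isometric_hom (MT X) (MT Y) (MT_map Y f)"
proof -
  interpret X: tripointed_metric X by fact
  interpret Y: tripointed_metric Y by fact
  have hom: "tri_hom X Y f"
    using assms(3) by (simp add: isometric_hom_def)
  then have f: "f u \<in> pts Y" if "u \<in> pts X" for u
    using that by (auto simp: tri_hom_def)
  note map = MT_map_tens[OF assms(1,2) hom]
  show ?thesis
    using hom unfolding isometric_hom_def
    by (auto simp: tri_hom_def X.corners_MT Y.corners_MT map f X.dst_MT Y.dst_MT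
          rep_dist_isometric_hom[OF assms(1,3)] elim!: X.pts_MT_E)
qed

section \<open>The colimit of the chain\<close>

lemma pts_transport_MT: "pts (transport (MT X)) = encode ` pts (MT X)"
  by (simp add: transport_def)

lemma decode_encode_MT: "C \<in> pts (MT X) \<Longrightarrow> decode (encode C) = C"
  by (rule decode_encode) (simp add: MT_def)

lemma dst_transport_MT:
  "C \<in> pts (MT X) \<Longrightarrow> D \<in> pts (MT X) \<Longrightarrow>
    dst (transport (MT X)) (encode C) (encode D) = dst (MT X) C D"
  by (simp add: transport_def decode_encode_MT)

lemma corners_transport:
  "topp (transport X) = encode (topp X)" "leftp (transport X) = encode (leftp X)"
  "rightp (transport X) = encode (rightp X)"
  by (simp_all add: transport_def)

text \<open>On codes of classes \<open>decode\<close> inverts \<open>encode\<close>, so the metric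
  axioms transfer. Off the carrier, nonnegativity and symmetry come from those of
  \<open>dst (MT X)\<close> on its whole type.\<close>

lemma tripointed_metric_transport_MT:
  assumes "tripointed_metric X"
  shows "tripointed_metric (transport (MT X))"
proof
  interpret X: tripointed_metric X by fact
  interpret MT: tripointed_metric "MT X" by (rule X.tripointed_metric_MT)
  have "Metric_space (pts (transport (MT X))) (dst (transport (MT X)))"
  proof
    fix x y z
    show "0 \<le> dst (transport (MT X)) x y"
      by (simp add: transport_def)
    show "dst (transport (MT X)) x y = dst (transport (MT X)) y x"
      by (simp add: transport_def MT.dst_commute)
    assume x: "x \<in> pts (transport (MT X))" and y: "y \<in> pts (transport (MT X))"
    then show "dst (transport (MT X)) x y = 0 \<longleftrightarrow> x = y"
      using decode_encode_MT[of _ X]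
      by (auto simp: pts_transport_MT dst_transport_MT MT.dst_zero)
    assume z: "z \<in> pts (transport (MT X))"
    show "dst (transport (MT X)) x z \<le> dst (transport (MT X)) x y + dst (transport (MT X)) y z"
      using x y z by (auto simp: pts_transport_MT dst_transport_MT MT.dst_triangle)
  qed
  then show "tripointed_metric_space (transport (MT X))"
    unfolding tripointed_metric_space_def tripointed_set_def
    by (auto simp: pts_transport_MT dst_transport_MT corners_transport MT.dst_le_1)
qed

lemma isometric_hom_transport_MT:
  assumes "tripointed_metric X" "isometric_hom (MT X) (MT Y) F"
  shows "isometric_hom (transport (MT X)) (transport (MT Y)) (encode \<circ> F \<circ> decode)"
proof -
  interpret X: tripointed_metric X by fact
  interpret MT: tripointed_metric "MT X" by (rule X.tripointed_metric_MT)
  have hom: "tri_hom (MT X) (MT Y) F"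
    using assms(2) by (simp add: isometric_hom_def)
  have dist: "dst (MT Y) (F C) (F D) = dst (MT X) C D" if "C \<in> pts (MT X)" "D \<in> pts (MT X)" for C D
    using assms(2) that by (simp add: isometric_hom_def)
  have F: "F C \<in> pts (MT Y)" if "C \<in> pts (MT X)" for C
    using hom that by (auto simp: tri_hom_def)
  show ?thesis
    using hom unfolding isometric_hom_def tri_hom_def
    by (auto simp: pts_transport_MT corners_transport decode_encode_MT[of _ X]
        dst_transport_MT F dist)
qed

section \<open>The iterates and their isometric chain maps\<close>

lemma tripointed_metric_three: "tripointed_metric three"
proof
  have "Metric_space (pts three) (dst three)"
    by unfold_locales (auto simp: three_def)
  then show "tripointed_metric_space three"
    by (auto simp: tripointed_metric_space_def tripointed_set_def three_def)
qed

lemma tripointed_metric_iter: "tripointed_metric (iter n)"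
  by (induction n) (simp_all add: tripointed_metric_three tripointed_metric_transport_MT)

interpretation iter: tripointed_metric "iter n" for n
  by (rule tripointed_metric_iter)

text \<open>The space \<open>three\<close> consists of corners only, and corners have the same
  mutual distances in every tri-pointed metric space, so \<open>bang\<close> is isometric; the
  functor and the transport preserve this.\<close>

lemma isometric_hom_chain: "isometric_hom (iter n) (iter (Suc n)) (chain n)"
proof (induction n)
  case 0
  have pts: "pts three = {topp three, leftp three, rightp three}"
    by (simp add: three_def)
  have "tens three Ma (topp three) = topp (MT three)" "tens three Mb (leftp three) = leftp (MT three)"
    "tens three Mc (rightp three) = rightp (MT three)"
    by (simp_all add: MT_def)
  then have bang: "bang (topp three) = topp (iter 1)" "bang (leftp three) = leftp (iter 1)"
    "bang (rightp three) = rightp (iter 1)"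
    by (simp_all add: corners_transport) (simp_all add: three_def)
  have "dst (iter 1) (bang x) (bang y) = dst (iter 0) x y" if "x \<in> pts three" "y \<in> pts three" for x y
    using that iter.dst_corners[of 0] iter.dst_corners[of 1] unfolding pts iter.simps(1)
    by (elim insertE) (simp_all only: bang, simp_all)
  moreover have "tri_hom three (iter 1) bang"
    using iter.corners_in[of 1] unfolding tri_hom_def pts by (simp add: bang del: One_nat_def)
  ultimately show ?case
    by (simp add: isometric_hom_def)
next
  case (Suc n)
  show ?case
    using isometric_hom_transport_MT[OF iter.tripointed_metric_axioms isometric_hom_MT_map[OF iter.tripointed_metric_axioms
            iter.tripointed_metric_axioms Suc]]
    unfolding chain.simps(2) iter.simps(2) .
qed

section \<open>Comparing elements of different stages\<close>

primrec push :: "nat \<Rightarrow> nat \<Rightarrow> univ \<Rightarrow> univ" where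
  "push n 0 x = x"
| "push n (Suc k) x = chain (n + k) (push n k x)"

text \<open>This is the image of \<open>p\<close> at stage \<open>k\<close> when
  \<open>fst p \<le> k\<close>; below that stage truncated subtraction would return the element
  unchanged.\<close>

definition up :: "nat \<Rightarrow> nat \<times> univ \<Rightarrow> univ" where
  "up k p = push (fst p) (k - fst p) (snd p)"

definition stages :: "(nat \<times> univ) set" where
  "stages = (SIGMA n:UNIV. pts (iter n))"

definition colim_dist :: "nat \<times> univ \<Rightarrow> nat \<times> univ \<Rightarrow> real" where
  "colim_dist p q = (let k = max (fst p) (fst q) in dst (iter k) (up k p) (up k q))"

lemma in_stages [simp]: "(n, x) \<in> stages \<longleftrightarrow> x \<in> pts (iter n)"
  by (simp add: stages_def)

lemma chain_in: "x \<in> pts (iter n) \<Longrightarrow> chain n x \<in> pts (iter (Suc n))"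
  using isometric_hom_chain[of n] by (auto simp: isometric_hom_def tri_hom_def)

lemma dst_chain:
  "x \<in> pts (iter n) \<Longrightarrow> y \<in> pts (iter n) \<Longrightarrow>
    dst (iter (Suc n)) (chain n x) (chain n y) = dst (iter n) x y"
  using isometric_hom_chain[of n] by (simp add: isometric_hom_def)

lemma chain_corners:
  "chain n (topp (iter n)) = topp (iter (Suc n))" "chain n (leftp (iter n)) = leftp (iter (Suc n))"
  "chain n (rightp (iter n)) = rightp (iter (Suc n))"
  using isometric_hom_chain[of n] by (simp_all add: isometric_hom_def tri_hom_def)

lemma up_self [simp]: "up n (n, x) = x"
  by (simp add: up_def)

lemma up_Suc: "fst p \<le> k \<Longrightarrow> up (Suc k) p = chain k (up k p)"
  by (simp add: up_def Suc_diff_le)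

lemma up_in: "fst p \<le> k \<Longrightarrow> p \<in> stages \<Longrightarrow> up k p \<in> pts (iter k)"
proof (induction k rule: dec_induct)
  case base
  then show ?case by (cases p) simp
next
  case (step k)
  then show ?case using chain_in by (simp add: up_Suc del: iter.simps)
qed

lemma dst_up:
  assumes "k \<le> l" "fst p \<le> k" "fst q \<le> k" "p \<in> stages" "q \<in> stages"
  shows "dst (iter l) (up l p) (up l q) = dst (iter k) (up k p) (up k q)"
  using assms
proof (induction l rule: dec_induct)
  case (step l)
  then show ?case by (simp add: up_Suc dst_chain up_in del: iter.simps)
qed simp

text \<open>The chain maps are isometric, so every common stage gives the same distance. This
  reduces the axioms for \<open>colim_dist\<close> to those of a single iterate.\<close>

lemma colim_dist_eq:
  assumes "fst p \<le> k" "fst q \<le> k" "p \<in> stages" "q \<in> stages"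
  shows "colim_dist p q = dst (iter k) (up k p) (up k q)"
  using dst_up[of "max (fst p) (fst q)" k p q] assms
  by (simp add: colim_dist_def Let_def)

lemma equivclp_up: "fst p \<le> k \<Longrightarrow> p \<in> stages \<Longrightarrow> equivclp chain_step p (k, up k p)"
proof (induction k rule: dec_induct)
  case base
  then show ?case by (cases p) simp
next
  case (step k)
  have "chain_step (k, up k p) (Suc k, up (Suc k) p)"
    using step up_in by (simp add: up_Suc chain_step.intros)
  then show ?case
    using step equivclp_into_equivclp by metis
qed

lemma colim_equiv_stages: "colim_equiv = gen_equiv stages chain_step"
  by (simp add: colim_equiv_def stages_def)

interpretation colim: pseudometric stages colim_dist colim_equiv
  unfolding colim_equiv_stages
proof (rule pseudometric_gen_equiv)
  fix p q r
  show "0 \<le> colim_dist p q"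
    by (simp add: colim_dist_def Let_def)
  show "colim_dist p q = colim_dist q p"
    by (simp add: colim_dist_def Let_def max.commute iter.dst_commute)
  show "colim_dist p p = 0" if "p \<in> stages"
    using that by (simp add: colim_dist_eq[of p "fst p" p] iter.dst_self up_in)
  show "colim_dist p r \<le> colim_dist p q + colim_dist q r"
    if "p \<in> stages" "q \<in> stages" "r \<in> stages"
    \<comment> \<open>The sum of the three stages serves as a stage above all of them.\<close>
    using that colim_dist_eq[of _ "fst p + fst q + fst r" _] by (simp add: iter.dst_triangle up_in)
  show "p \<in> stages \<and> q \<in> stages \<and> colim_dist p q = 0" if "chain_step p q"
    using that
  proof cases
    case (1 x n)
    then have "colim_dist p q = 0"
      using colim_dist_eq[of p "Suc n" q] chain_in[of x n]
      by (simp add: up_Suc iter.dst_self del: iter.simps)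
    then show ?thesis
      using 1 chain_in[of x n] by (simp del: iter.simps)
  qed
  show "equivclp chain_step p q" if "p \<in> stages" "q \<in> stages" "colim_dist p q = 0"
  proof -
    let ?k = "fst p + fst q"
    \<comment> \<open>Distance \<open>0\<close> at a common stage means that the two images there
      are one element, to which both \<open>p\<close> and \<open>q\<close> are linked by chain
      steps.\<close>
    have "up ?k p = up ?k q"
      using that colim_dist_eq[of p ?k q] by (simp add: iter.dst_zero up_in)
    then show ?thesis
      using equivclp_up[of p ?k] equivclp_up[of q ?k] that equivclp_trans equivclp_sym
      by (metis le_add1 le_add2)
  qed
qed

lemma colim_class_in: "x \<in> pts (iter n) \<Longrightarrow> colim_class n x \<in> pts G"
  by (auto simp: G_def colim_class_def intro!: quotientI)

lemma pts_G: "pts G = stages // colim_equiv"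
  by (simp add: G_def stages_def)

lemma dst_G: "dst G = dist_on (stages // colim_equiv)
  (\<lambda>P Q. THE r. \<exists>n x y. (n, x) \<in> P \<and> (n, y) \<in> Q \<and> r = dst (iter n) x y)"
  by (simp add: G_def stages_def)

text \<open>The description ranges only over representatives at a common stage, so
  \<open>the_dist\<close> does not apply as it stands. Both classes have representatives at the
  stage \<open>?k\<close>, and \<open>dist_cong\<close> gives uniqueness.\<close>

lemma the_dst_G:
  assumes "p \<in> stages" "q \<in> stages"
  shows "(THE r. \<exists>n x y. (n, x) \<in> colim_equiv `` {p} \<and> (n, y) \<in> colim_equiv `` {q} \<and>
            r = dst (iter n) x y) = colim_dist p q"
proof (rule the_equality)
  let ?k = "fst p + fst q"
  have "(p, (?k, up ?k p)) \<in> colim_equiv" "(q, (?k, up ?k q)) \<in> colim_equiv"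
    using assms equivclp_up up_in by (auto simp: colim_equiv_stages gen_equiv_def)
  then show "\<exists>n x y. (n, x) \<in> colim_equiv `` {p} \<and> (n, y) \<in> colim_equiv `` {q} \<and>
      colim_dist p q = dst (iter n) x y"
    using colim_dist_eq[of p ?k q] assms by auto
next
  fix r assume "\<exists>n x y. (n, x) \<in> colim_equiv `` {p} \<and> (n, y) \<in> colim_equiv `` {q} \<and>
      r = dst (iter n) x y"
  then obtain n x y where xy: "(p, (n, x)) \<in> colim_equiv" "(q, (n, y)) \<in> colim_equiv"
    and r: "r = dst (iter n) x y"
    by auto
  then have "r = colim_dist (n, x) (n, y)"
    using colim_dist_eq[of "(n, x)" n "(n, y)"] by (simp add: colim.rel_iff)
  then show "r = colim_dist p q"
    using colim.dist_cong[OF xy] by simp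
qed

lemma dst_G_class:
  assumes "p \<in> stages" "q \<in> stages"
  shows "dst G (colim_equiv `` {p}) (colim_equiv `` {q}) = colim_dist p q"
  using assms the_dst_G[OF assms] by (simp add: dst_G dist_on_def quotientI)

lemma dst_colim_class:
  assumes "x \<in> pts (iter n)" "y \<in> pts (iter n)"
  shows "dst G (colim_class n x) (colim_class n y) = dst (iter n) x y"
  using assms colim_dist_eq[of "(n, x)" n "(n, y)"] by (simp add: colim_class_def dst_G_class)

lemma colim_class_chain:
  assumes "x \<in> pts (iter n)"
  shows "colim_class (Suc n) (chain n x) = colim_class n x"
proof -
  have "((n, x), (Suc n, chain n x)) \<in> colim_equiv"
    using assms chain_in by (auto simp: colim_equiv_stages gen_equiv_def intro: chain_step.intros)
  then show ?thesis
    unfolding colim_class_def using colim.equiv_rel equiv_class_eq by metis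
qed

lemma colim_class_corners:
  "colim_class n (topp (iter n)) = topp G" "colim_class n (leftp (iter n)) = leftp G"
  "colim_class n (rightp (iter n)) = rightp G"
proof (induction n)
  case 0
  show "colim_class 0 (topp (iter 0)) = topp G" "colim_class 0 (leftp (iter 0)) = leftp G"
    "colim_class 0 (rightp (iter 0)) = rightp G"
    by (simp_all add: G_def three_def)
next
  case (Suc n)
  then show "colim_class (Suc n) (topp (iter (Suc n))) = topp G"
    "colim_class (Suc n) (leftp (iter (Suc n))) = leftp G"
    "colim_class (Suc n) (rightp (iter (Suc n))) = rightp G"
    using colim_class_chain[of "topp (iter n)" n] colim_class_chain[of "leftp (iter n)" n]
      colim_class_chain[of "rightp (iter n)" n]
    by (simp_all add: chain_corners del: iter.simps)
qed

lemma isometric_hom_colim_class: "isometric_hom (iter n) G (colim_class n)"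
  by (simp add: isometric_hom_def tri_hom_def colim_class_in dst_colim_class colim_class_corners)

lemma pts_G_E:
  assumes "P \<in> pts G"
  obtains n x where "x \<in> pts (iter n)" "P = colim_class n x"
  using assms by (auto simp: pts_G colim_class_def elim!: quotientE)

lemma tripointed_metric_G: "tripointed_metric G"
proof
  have metric: "Metric_space (pts G) (dst G)"
    unfolding pts_G dst_G by (rule colim.Metric_space_quotient) (rule the_dst_G)
  have le: "dst G P Q \<le> 1" if "P \<in> pts G" "Q \<in> pts G" for P Q
  proof -
    obtain p q where "p \<in> stages" "q \<in> stages" "P = colim_equiv `` {p}" "Q = colim_equiv `` {q}"
      using \<open>P \<in> pts G\<close> \<open>Q \<in> pts G\<close> unfolding pts_G by (auto elim!: quotientE)
    then show ?thesis
      by (simp add: dst_G_class colim_dist_def Let_def iter.dst_le_1 up_in)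
  qed
  have corners: "topp G = colim_class 0 (topp three)" "leftp G = colim_class 0 (leftp three)"
    "rightp G = colim_class 0 (rightp three)"
    using colim_class_corners[of 0] by simp_all
  have "topp three \<in> pts three" "leftp three \<in> pts three" "rightp three \<in> pts three"
    using iter.corners_in[of 0] by simp_all
  then show "tripointed_metric_space G"
    using metric le colim_class_in[of _ 0] dst_colim_class[of _ 0] iter.dst_corners[of 0]
    by (simp add: tripointed_metric_space_def tripointed_set_def corners)
qed

interpretation G: tripointed_metric G
  by (rule tripointed_metric_G)

section \<open>The initial algebra\<close>

text \<open>This is the value of \<open>g\<close> at \<open>m \<otimes> [x]\<close> computed from
  one representative, used before \<open>g\<close> is known to be well defined.\<close>

definition graft :: "mon \<Rightarrow> nat \<Rightarrow> univ \<Rightarrow> (nat \<times> univ) set" where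
  "graft m n x = colim_class (Suc n) (encode (tens (iter n) m x))"

lemma iter_Suc_in: "x \<in> pts (iter n) \<Longrightarrow> encode (tens (iter n) m x) \<in> pts (iter (Suc n))"
  by (simp add: pts_transport_MT)

lemma dst_iter_Suc:
  "x \<in> pts (iter n) \<Longrightarrow> y \<in> pts (iter n) \<Longrightarrow>
    dst (iter (Suc n)) (encode (tens (iter n) m x)) (encode (tens (iter n) k y)) =
    rep_dist (iter n) (m, x) (k, y)"
  by (simp add: dst_transport_MT iter.dst_MT)

lemma graft_in: "x \<in> pts (iter n) \<Longrightarrow> graft m n x \<in> pts G"
  unfolding graft_def by (intro colim_class_in iter_Suc_in)

text \<open>The next chain map sends \<open>m \<otimes> x\<close> to
  \<open>m \<otimes> chain n x\<close>, so prefixing a letter commutes with moving up one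
  stage.\<close>

lemma graft_chain:
  assumes "x \<in> pts (iter n)"
  shows "graft m (Suc n) (chain n x) = graft m n x"
proof -
  have "chain (Suc n) (encode (tens (iter n) m x)) = encode (tens (iter (Suc n)) m (chain n x))"
    using assms isometric_hom_chain[of n]
      MT_map_tens[OF tripointed_metric_iter tripointed_metric_iter, of n "Suc n" "chain n" x m]
    by (simp add: decode_encode_MT[of _ "iter n"] isometric_hom_def)
  then show ?thesis
    unfolding graft_def using colim_class_chain[OF iter_Suc_in[OF assms, of m]] by simp
qed

text \<open>Two points given at different stages can thus be compared at one stage without changing
  their classes or their grafts.\<close>

lemma raise_stage:
  assumes "n \<le> k" "x \<in> pts (iter n)"
  shows "\<exists>y\<in>pts (iter k). colim_class k y = colim_class n x \<and> (\<forall>m. graft m k y = graft m n x)"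
  using assms
proof (induction k rule: dec_induct)
  case (step k)
  then show ?case
    using chain_in colim_class_chain graft_chain by metis
qed blast

text \<open>At a common stage both sides are the same \<open>rep_dist\<close> of an iterate. This
  yields the isometry of \<open>g\<close> and also its well-definedness.\<close>

lemma dst_graft:
  assumes "x \<in> pts (iter n)" "y \<in> pts (iter l)"
  shows "dst G (graft m n x) (graft k l y) = rep_dist G (m, colim_class n x) (k, colim_class l y)"
proof -
  obtain x' where x': "x' \<in> pts (iter (n + l))" "colim_class (n + l) x' = colim_class n x"
    "graft m (n + l) x' = graft m n x"
    using raise_stage[of n "n + l" x] assms by auto
  obtain y' where y': "y' \<in> pts (iter (n + l))" "colim_class (n + l) y' = colim_class l y"
    "graft k (n + l) y' = graft k l y"
    using raise_stage[of l "n + l" y] assms by auto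
  have "dst G (graft m (n + l) x') (graft k (n + l) y') = rep_dist (iter (n + l)) (m, x') (k, y')"
    using dst_colim_class[OF iter_Suc_in iter_Suc_in, OF x'(1) y'(1)] dst_iter_Suc[OF x'(1) y'(1)]
    by (simp add: graft_def del: iter.simps)
  then show ?thesis
    using x' y' rep_dist_isometric_hom[OF tripointed_metric_iter isometric_hom_colim_class x'(1) y'(1)]
    by simp
qed

lemma in_colim_class_iff:
  assumes "x \<in> pts (iter n)"
  shows "(l, y) \<in> colim_class n x \<longleftrightarrow> y \<in> pts (iter l) \<and> colim_class l y = colim_class n x"
proof -
  have "(l, y) \<in> colim_class n x \<longleftrightarrow> y \<in> pts (iter l) \<and> colim_dist (n, x) (l, y) = 0"
    using assms by (simp add: colim_class_def colim.rel_iff)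
  then show ?thesis
    using assms colim.class_eq_iff[of "(n, x)" "(l, y)"] by (auto simp: colim_class_def)
qed

lemma g_tens_colim_class:
  assumes "x \<in> pts (iter n)"
  shows "g (tens G m (colim_class n x)) = graft m n x"
  unfolding g_def
proof (rule the_equality)
  have "(m, colim_class n x) \<in> tens G m (colim_class n x)" "(n, x) \<in> colim_class n x"
    using assms by (simp_all add: G.in_tens_iff colim_class_in in_colim_class_iff)
  then show "\<exists>k P l y. (k, P) \<in> tens G m (colim_class n x) \<and> (l, y) \<in> P \<and>
      graft m n x = colim_class (Suc l) (encode (tens (iter l) k y))"
    unfolding graft_def by blast
next
  fix Q
  assume "\<exists>k P l y. (k, P) \<in> tens G m (colim_class n x) \<and> (l, y) \<in> P \<and>
      Q = colim_class (Suc l) (encode (tens (iter l) k y))"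
  then obtain k P l y where P: "(k, P) \<in> tens G m (colim_class n x)" "(l, y) \<in> P"
    and Q: "Q = graft k l y"
    unfolding graft_def by blast
  have P_in: "P \<in> pts G" and P_eq: "tens G k P = tens G m (colim_class n x)"
    using P(1) assms by (simp_all add: G.in_tens_iff colim_class_in)
  obtain l' y' where "y' \<in> pts (iter l')" "P = colim_class l' y'"
    using P_in by (rule pts_G_E)
  then have y: "y \<in> pts (iter l)" "P = colim_class l y"
    using P(2) in_colim_class_iff by auto
  then have "dst G (graft k l y) (graft m n x) = 0"
    using P_in P_eq assms by (simp add: dst_graft G.tens_eq_iff colim_class_in)
  then show "Q = graft m n x"
    using Q assms y by (simp add: G.dst_zero graft_in)
qed

lemma g_tens_in: "P \<in> pts G \<Longrightarrow> g (tens G m P) \<in> pts G"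
  by (auto elim!: pts_G_E simp: g_tens_colim_class graft_in)

lemma dst_g_tens:
  "P \<in> pts G \<Longrightarrow> Q \<in> pts G \<Longrightarrow> dst G (g (tens G m P)) (g (tens G k Q)) = rep_dist G (m, P) (k, Q)"
  by (auto elim!: pts_G_E simp: g_tens_colim_class dst_graft)

text \<open>An element of stage \<open>0\<close> has no first letter. Moving any representative up
  one stage gives a tensor without changing the class.\<close>

lemma g_tens_surj:
  assumes "P \<in> pts G"
  obtains m Q where "Q \<in> pts G" "P = g (tens G m Q)"
proof -
  obtain n x where x: "x \<in> pts (iter n)" "P = colim_class n x"
    using assms by (rule pts_G_E)
  have "chain n x \<in> pts (iter (Suc n))"
    using x(1) by (rule chain_in)
  then obtain m y where "y \<in> pts (iter n)" "chain n x = encode (tens (iter n) m y)"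
    by (auto simp: pts_transport_MT elim!: iter.pts_MT_E)
  then have "P = g (tens G m (colim_class n y))" "colim_class n y \<in> pts G"
    using x colim_class_chain[OF x(1)] by (simp_all add: g_tens_colim_class graft_def colim_class_in)
  then show thesis
    using that by blast
qed

lemma g_tens_corners:
  "g (tens G Ma (topp G)) = topp G" "g (tens G Mb (leftp G)) = leftp G"
  "g (tens G Mc (rightp G)) = rightp G"
proof -
  have "colim_class (Suc 0) (topp (iter (Suc 0))) = g (tens G Ma (colim_class 0 (topp (iter 0))))"
    "colim_class (Suc 0) (leftp (iter (Suc 0))) = g (tens G Mb (colim_class 0 (leftp (iter 0))))"
    "colim_class (Suc 0) (rightp (iter (Suc 0))) = g (tens G Mc (colim_class 0 (rightp (iter 0))))"
    using iter.corners_in[of 0]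
    by (simp_all add: g_tens_colim_class graft_def corners_transport iter.corners_MT[of 0, simplified])
  then show "g (tens G Ma (topp G)) = topp G" "g (tens G Mb (leftp G)) = leftp G"
    "g (tens G Mc (rightp G)) = rightp G"
    unfolding colim_class_corners by simp_all
qed

section \<open>Cauchy completion\<close>

context tripointed_metric
begin

lemma cauchy_seqs_in: "\<sigma> \<in> cauchy_seqs X \<Longrightarrow> \<sigma> n \<in> pts X"
  using Metric_space.MCauchy_def[OF Metric_space_dst] by (auto simp: cauchy_seqs_def)

lemma cauchy_seqs_iff:
  "\<sigma> \<in> cauchy_seqs X \<longleftrightarrow>
    (\<forall>n. \<sigma> n \<in> pts X) \<and> (\<forall>\<epsilon>>0. \<exists>N. \<forall>n n'. N \<le> n \<longrightarrow> N \<le> n' \<longrightarrow> dst X (\<sigma> n) (\<sigma> n') < \<epsilon>)"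
  by (auto simp: cauchy_seqs_def Metric_space.MCauchy_def[OF Metric_space_dst])

lemma const_cauchy [simp]: "x \<in> pts X \<Longrightarrow> (\<lambda>_. x) \<in> cauchy_seqs X"
  by (simp add: cauchy_seqs_iff dst_self)

definition lim_dist :: "(nat \<Rightarrow> 'a) \<Rightarrow> (nat \<Rightarrow> 'a) \<Rightarrow> real" where
  "lim_dist \<sigma> \<tau> = lim (\<lambda>n. dst X (\<sigma> n) (\<tau> n))"

text \<open>Distances between terms change by at most the sum of the two displacements, so they form
  a Cauchy sequence of reals.\<close>

lemma tendsto_lim_dist:
  assumes "\<sigma> \<in> cauchy_seqs X" "\<tau> \<in> cauchy_seqs X"
  shows "(\<lambda>n. dst X (\<sigma> n) (\<tau> n)) \<longlonglongrightarrow> lim_dist \<sigma> \<tau>"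
proof -
  have "Cauchy (\<lambda>n. dst X (\<sigma> n) (\<tau> n))"
  proof (rule metric_CauchyI)
    fix \<epsilon> :: real
    assume "\<epsilon> > 0"
    then have "\<epsilon> / 2 > 0" by simp
    then obtain N N' where
      N: "\<forall>n n'. N \<le> n \<longrightarrow> N \<le> n' \<longrightarrow> dst X (\<sigma> n) (\<sigma> n') < \<epsilon> / 2" and
      N': "\<forall>n n'. N' \<le> n \<longrightarrow> N' \<le> n' \<longrightarrow> dst X (\<tau> n) (\<tau> n') < \<epsilon> / 2"
      using assms unfolding cauchy_seqs_iff by meson
    have "dist (dst X (\<sigma> n) (\<tau> n)) (dst X (\<sigma> n') (\<tau> n')) < \<epsilon>" if "n \<ge> max N N'" "n' \<ge> max N N'" for n n'
    proof -
      have "dst X (\<sigma> n) (\<sigma> n') < \<epsilon> / 2" "dst X (\<tau> n) (\<tau> n') < \<epsilon> / 2"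
        using N N' that by auto
      moreover have in_X: "\<sigma> n \<in> pts X" "\<sigma> n' \<in> pts X" "\<tau> n \<in> pts X" "\<tau> n' \<in> pts X"
        using assms cauchy_seqs_in by auto
      moreover have "dst X (\<sigma> n) (\<tau> n) \<le> dst X (\<sigma> n) (\<sigma> n') + dst X (\<sigma> n') (\<tau> n') + dst X (\<tau> n') (\<tau> n)"
        using dst_triangle[of "\<sigma> n" "\<sigma> n'" "\<tau> n"] dst_triangle[of "\<sigma> n'" "\<tau> n'" "\<tau> n"] in_X by simp
      moreover have "dst X (\<sigma> n') (\<tau> n') \<le> dst X (\<sigma> n') (\<sigma> n) + dst X (\<sigma> n) (\<tau> n) + dst X (\<tau> n) (\<tau> n')"
        using dst_triangle[of "\<sigma> n'" "\<sigma> n" "\<tau> n'"] dst_triangle[of "\<sigma> n" "\<tau> n" "\<tau> n'"] in_X by simp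
      moreover have "dst X (\<sigma> n') (\<sigma> n) = dst X (\<sigma> n) (\<sigma> n')" "dst X (\<tau> n') (\<tau> n) = dst X (\<tau> n) (\<tau> n')"
        by (rule dst_commute)+
      ultimately show ?thesis
        unfolding dist_real_def abs_less_iff by linarith
    qed
    then show "\<exists>M. \<forall>m\<ge>M. \<forall>n\<ge>M. dist (dst X (\<sigma> m) (\<tau> m)) (dst X (\<sigma> n) (\<tau> n)) < \<epsilon>"
      by blast
  qed
  then show ?thesis
    unfolding lim_dist_def by (simp add: Cauchy_convergent convergent_LIMSEQ_iff[symmetric])
qed

lemma lim_dist_eqI:
  assumes "\<sigma> \<in> cauchy_seqs X" "\<tau> \<in> cauchy_seqs X" "(\<lambda>n. dst X (\<sigma> n) (\<tau> n)) \<longlonglongrightarrow> r"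
  shows "lim_dist \<sigma> \<tau> = r"
  using LIMSEQ_unique tendsto_lim_dist assms by blast

sublocale lim: pseudometric "cauchy_seqs X" lim_dist "cauchy_equiv X"
proof
  fix \<sigma> \<tau> \<rho>
  assume seqs: "\<sigma> \<in> cauchy_seqs X" "\<tau> \<in> cauchy_seqs X"
  show "0 \<le> lim_dist \<sigma> \<tau>"
    using tendsto_lim_dist[OF seqs] by (rule LIMSEQ_le_const) simp
  show "lim_dist \<sigma> \<tau> = lim_dist \<tau> \<sigma>"
    unfolding lim_dist_def by (simp add: dst_commute)
  assume "\<rho> \<in> cauchy_seqs X"
  then have "(\<lambda>n. dst X (\<sigma> n) (\<rho> n)) \<longlonglongrightarrow> lim_dist \<sigma> \<rho>"
    "(\<lambda>n. dst X (\<sigma> n) (\<tau> n) + dst X (\<tau> n) (\<rho> n)) \<longlonglongrightarrow> lim_dist \<sigma> \<tau> + lim_dist \<tau> \<rho>"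
    using seqs by (simp_all add: tendsto_lim_dist tendsto_add)
  then show "lim_dist \<sigma> \<rho> \<le> lim_dist \<sigma> \<tau> + lim_dist \<tau> \<rho>"
    by (rule LIMSEQ_le) (use seqs \<open>\<rho> \<in> _\<close> cauchy_seqs_in dst_triangle in blast)
next
  fix \<sigma> assume "\<sigma> \<in> cauchy_seqs X"
  then show "lim_dist \<sigma> \<sigma> = 0"
    by (intro lim_dist_eqI) (simp_all add: dst_self cauchy_seqs_in)
next
  fix \<sigma> \<tau>
  show "(\<sigma>, \<tau>) \<in> cauchy_equiv X \<longleftrightarrow> \<sigma> \<in> cauchy_seqs X \<and> \<tau> \<in> cauchy_seqs X \<and> lim_dist \<sigma> \<tau> = 0"
    using lim_dist_eqI tendsto_lim_dist by (fastforce simp: cauchy_equiv_def)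
qed

lemma pts_completion: "pts (completion X) = cauchy_seqs X // cauchy_equiv X"
  by (simp add: completion_def)

lemma corners_completion:
  "topp (completion X) = cauchy_class X (\<lambda>_. topp X)"
  "leftp (completion X) = cauchy_class X (\<lambda>_. leftp X)"
  "rightp (completion X) = cauchy_class X (\<lambda>_. rightp X)"
  by (simp_all add: completion_def incl_def)

lemma cauchy_class_in: "\<sigma> \<in> cauchy_seqs X \<Longrightarrow> cauchy_class X \<sigma> \<in> pts (completion X)"
  by (simp add: pts_completion cauchy_class_def quotientI)

lemma pts_completion_E:
  assumes "P \<in> pts (completion X)"
  obtains \<sigma> where "\<sigma> \<in> cauchy_seqs X" "P = cauchy_class X \<sigma>"
  using assms by (auto simp: pts_completion cauchy_class_def elim!: quotientE)

lemma the_dst_completion: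
  assumes "\<sigma> \<in> cauchy_seqs X" "\<tau> \<in> cauchy_seqs X"
  shows "(THE r. \<exists>\<sigma>'\<in>cauchy_equiv X `` {\<sigma>}. \<exists>\<tau>'\<in>cauchy_equiv X `` {\<tau>}.
            (\<lambda>n. dst X (\<sigma>' n) (\<tau>' n)) \<longlonglongrightarrow> r) = lim_dist \<sigma> \<tau>"
proof -
  have "(\<lambda>n. dst X (\<sigma>' n) (\<tau>' n)) \<longlonglongrightarrow> r \<longleftrightarrow> r = lim_dist \<sigma>' \<tau>'"
    if "\<sigma>' \<in> cauchy_equiv X `` {\<sigma>}" "\<tau>' \<in> cauchy_equiv X `` {\<tau>}" for \<sigma>' \<tau>' r
    using that lim_dist_eqI tendsto_lim_dist by (auto simp: lim.rel_iff)
  then have "(THE r. \<exists>\<sigma>'\<in>cauchy_equiv X `` {\<sigma>}. \<exists>\<tau>'\<in>cauchy_equiv X `` {\<tau>}.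
            (\<lambda>n. dst X (\<sigma>' n) (\<tau>' n)) \<longlonglongrightarrow> r) =
        (THE r. \<exists>\<sigma>'\<in>cauchy_equiv X `` {\<sigma>}. \<exists>\<tau>'\<in>cauchy_equiv X `` {\<tau>}. r = lim_dist \<sigma>' \<tau>')"
    by (intro arg_cong[of _ _ The] ext bex_cong refl)
  then show ?thesis
    using lim.the_dist assms by simp
qed

lemma dst_completion: "dst (completion X) = dist_on (cauchy_seqs X // cauchy_equiv X)
    (\<lambda>P Q. THE r. \<exists>\<sigma>\<in>P. \<exists>\<tau>\<in>Q. (\<lambda>n. dst X (\<sigma> n) (\<tau> n)) \<longlonglongrightarrow> r)"
  by (simp add: completion_def)

lemma dst_cauchy_class:
  assumes "\<sigma> \<in> cauchy_seqs X" "\<tau> \<in> cauchy_seqs X"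
  shows "dst (completion X) (cauchy_class X \<sigma>) (cauchy_class X \<tau>) = lim_dist \<sigma> \<tau>"
  using assms the_dst_completion[OF assms]
  by (simp add: dst_completion dist_on_def cauchy_class_def quotientI del: Image_singleton_iff)

lemma lim_dist_le:
  assumes "\<sigma> \<in> cauchy_seqs X" "\<tau> \<in> cauchy_seqs X" "\<And>n. n \<ge> N \<Longrightarrow> dst X (\<sigma> n) (\<tau> n) \<le> r"
  shows "lim_dist \<sigma> \<tau> \<le> r"
  using tendsto_lim_dist[OF assms(1,2)] by (rule LIMSEQ_le_const2) (use assms(3) in blast)

lemma lim_dist_const: "x \<in> pts X \<Longrightarrow> y \<in> pts X \<Longrightarrow> lim_dist (\<lambda>_. x) (\<lambda>_. y) = dst X x y"
  by (intro lim_dist_eqI) simp_all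

lemma cauchy_class_eqI:
  "\<sigma> \<in> cauchy_seqs X \<Longrightarrow> \<tau> \<in> cauchy_seqs X \<Longrightarrow> (\<lambda>n. dst X (\<sigma> n) (\<tau> n)) \<longlonglongrightarrow> 0 \<Longrightarrow>
    cauchy_class X \<sigma> = cauchy_class X \<tau>"
  unfolding cauchy_class_def using lim.class_eq_iff lim_dist_eqI by blast

lemma in_cauchy_class_iff:
  assumes "\<sigma> \<in> cauchy_seqs X"
  shows "\<tau> \<in> cauchy_class X \<sigma> \<longleftrightarrow> \<tau> \<in> cauchy_seqs X \<and> cauchy_class X \<tau> = cauchy_class X \<sigma>"
proof -
  have "\<tau> \<in> cauchy_class X \<sigma> \<longleftrightarrow> \<tau> \<in> cauchy_seqs X \<and> lim_dist \<sigma> \<tau> = 0"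
    using assms by (simp add: cauchy_class_def lim.rel_iff)
  then show ?thesis
    using assms lim.class_eq_iff[of \<sigma> \<tau>] by (auto simp: cauchy_class_def)
qed

lemma tripointed_metric_completion: "tripointed_metric (completion X)"
proof
  have "Metric_space (pts (completion X)) (dst (completion X))"
    unfolding pts_completion dst_completion
    by (rule lim.Metric_space_quotient) (rule the_dst_completion)
  moreover have "dst (completion X) P Q \<le> 1" if P: "P \<in> pts (completion X)" and Q: "Q \<in> pts (completion X)" for P Q
  proof -
    obtain \<sigma> \<tau> where "\<sigma> \<in> cauchy_seqs X" "\<tau> \<in> cauchy_seqs X"
      "P = cauchy_class X \<sigma>" "Q = cauchy_class X \<tau>"
      using P Q by (meson pts_completion_E)
    then show ?thesis
      using lim_dist_le[of \<sigma> \<tau> 0 1] cauchy_seqs_in dst_le_1 by (simp add: dst_cauchy_class)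
  qed
  ultimately show "tripointed_metric_space (completion X)"
    by (simp add: tripointed_metric_space_def tripointed_set_def corners_completion
        dst_cauchy_class lim_dist_const cauchy_class_in)
qed

text \<open>Every Cauchy sequence converges, in the completion, to its own class; this identifies
  the limits of the sequences \<open>\<theta>\<close>.\<close>

lemma tendsto_incl:
  assumes "\<sigma> \<in> cauchy_seqs X"
  shows "(\<lambda>k. dst (completion X) (incl X (\<sigma> k)) (cauchy_class X \<sigma>)) \<longlonglongrightarrow> 0"
proof (rule LIMSEQ_I)
  fix \<epsilon> :: real
  assume "\<epsilon> > 0"
  then obtain N where N: "\<forall>n n'. N \<le> n \<longrightarrow> N \<le> n' \<longrightarrow> dst X (\<sigma> n) (\<sigma> n') < \<epsilon> / 2"
    using assms unfolding cauchy_seqs_iff by (meson half_gt_zero)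
  have in_X: "\<sigma> n \<in> pts X" for n
    using assms by (rule cauchy_seqs_in)
  have "norm (dst (completion X) (incl X (\<sigma> k)) (cauchy_class X \<sigma>) - 0) < \<epsilon>" if "k \<ge> N" for k
  proof -
    \<comment> \<open>Passing to the limit weakens the strict bound, hence the choice of half of
      \<open>\<epsilon>\<close>.\<close>
    have "lim_dist (\<lambda>_. \<sigma> k) \<sigma> \<le> \<epsilon> / 2"
      using N that assms in_X by (intro lim_dist_le[where N = N]) (auto intro: less_imp_le)
    moreover have "0 \<le> lim_dist (\<lambda>_. \<sigma> k) \<sigma>"
      using assms in_X by (intro lim.nonneg) auto
    ultimately show ?thesis
      using \<open>\<epsilon> > 0\<close> assms in_X by (simp add: incl_def dst_cauchy_class)
  qed
  then show "\<exists>N. \<forall>k\<ge>N. norm (dst (completion X) (incl X (\<sigma> k)) (cauchy_class X \<sigma>) - 0) < \<epsilon>"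
    by blast
qed

text \<open>Used in two ways: to select the terms of a sequence lying in one copy, and to drop the
  term of index \<open>0\<close>.\<close>

lemma subseq_cauchy:
  assumes "\<sigma> \<in> cauchy_seqs X" "strict_mono r"
  shows "\<sigma> \<circ> r \<in> cauchy_seqs X" "cauchy_class X (\<sigma> \<circ> r) = cauchy_class X \<sigma>"
proof -
  have r: "n \<le> r n" for n
    using assms(2) by (rule seq_suble)
  have ev: "\<exists>N. \<forall>n n'. N \<le> n \<longrightarrow> N \<le> n' \<longrightarrow> dst X (\<sigma> n) (\<sigma> n') < \<epsilon>" if "\<epsilon> > 0" for \<epsilon>
    using assms(1) that by (simp add: cauchy_seqs_iff)
  show sub: "\<sigma> \<circ> r \<in> cauchy_seqs X"
    unfolding cauchy_seqs_iff
  proof (intro conjI allI impI)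
    fix n show "(\<sigma> \<circ> r) n \<in> pts X"
      using cauchy_seqs_in[OF assms(1)] by simp
  next
    fix \<epsilon> :: real assume "\<epsilon> > 0"
    from ev[OF this] show "\<exists>N. \<forall>n n'. N \<le> n \<longrightarrow> N \<le> n' \<longrightarrow> dst X ((\<sigma> \<circ> r) n) ((\<sigma> \<circ> r) n') < \<epsilon>"
      using r order_trans unfolding comp_def by meson
  qed
  have "(\<lambda>n. dst X ((\<sigma> \<circ> r) n) (\<sigma> n)) \<longlonglongrightarrow> 0"
  proof (rule LIMSEQ_I)
    fix \<epsilon> :: real assume "\<epsilon> > 0"
    from ev[OF this] obtain N where N: "\<forall>n n'. N \<le> n \<longrightarrow> N \<le> n' \<longrightarrow> dst X (\<sigma> n) (\<sigma> n') < \<epsilon>" ..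
    have "norm (dst X ((\<sigma> \<circ> r) n) (\<sigma> n) - 0) < \<epsilon>" if "n \<ge> N" for n
      using N that r[of n] by simp
    then show "\<exists>N. \<forall>n\<ge>N. norm (dst X ((\<sigma> \<circ> r) n) (\<sigma> n) - 0) < \<epsilon>"
      by blast
  qed
  then show "cauchy_class X (\<sigma> \<circ> r) = cauchy_class X \<sigma>"
    by (rule cauchy_class_eqI[OF sub assms(1)])
qed

text \<open>The formula is continuous in the distances it contains, being made of sums, minima and
  halving.\<close>

lemma tendsto_rep_dist:
  assumes "\<sigma> \<in> cauchy_seqs X" "\<tau> \<in> cauchy_seqs X"
  shows "(\<lambda>n. rep_dist X (m, \<sigma> n) (k, \<tau> n)) \<longlonglongrightarrow>
    rep_dist (completion X) (m, cauchy_class X \<sigma>) (k, cauchy_class X \<tau>)"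
proof -
  note lims = tendsto_lim_dist[OF assms] tendsto_lim_dist[OF assms(2,1)]
    tendsto_lim_dist[OF assms(1) const_cauchy] tendsto_lim_dist[OF assms(2) const_cauchy]
    tendsto_lim_dist[OF const_cauchy assms(1)] tendsto_lim_dist[OF const_cauchy assms(2)]
  show ?thesis
    using assms
    by (cases m; cases k)
       (auto simp: dst_cauchy_class corners_completion
          intro!: tendsto_divide tendsto_min tendsto_add lims)
qed

end

section \<open>The isomorphism \<open>s\<close> and its inverse\<close>

interpretation S: tripointed_metric S
  unfolding S_def by (rule G.tripointed_metric_completion)

lemma cauchy_class_in_S: "\<sigma> \<in> cauchy_seqs G \<Longrightarrow> cauchy_class G \<sigma> \<in> pts S"
  unfolding S_def by (rule G.cauchy_class_in)

lemma pts_S_E: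
  assumes "P \<in> pts S"
  obtains \<sigma> where "\<sigma> \<in> cauchy_seqs G" "P = cauchy_class G \<sigma>"
  using assms unfolding S_def by (rule G.pts_completion_E)

lemma g_tens_cauchy:
  assumes "\<sigma> \<in> cauchy_seqs G"
  shows "(\<lambda>n. g (tens G m (\<sigma> n))) \<in> cauchy_seqs G"
  unfolding G.cauchy_seqs_iff
proof (intro conjI allI impI)
  have \<sigma>: "\<sigma> n \<in> pts G" for n
    using assms by (rule G.cauchy_seqs_in)
  then show "g (tens G m (\<sigma> n)) \<in> pts G" for n
    by (rule g_tens_in)
  fix \<epsilon> :: real
  assume "\<epsilon> > 0"
  then have "\<epsilon> * 2 > 0" by simp
  then obtain N where "\<forall>n n'. N \<le> n \<longrightarrow> N \<le> n' \<longrightarrow> dst G (\<sigma> n) (\<sigma> n') < \<epsilon> * 2"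
    using assms unfolding G.cauchy_seqs_iff by meson
  then show "\<exists>N. \<forall>n n'. N \<le> n \<longrightarrow> N \<le> n' \<longrightarrow> dst G (g (tens G m (\<sigma> n))) (g (tens G m (\<sigma> n'))) < \<epsilon>"
    using \<sigma> by (auto simp: dst_g_tens G.rep_dist_same)
qed

lemma dst_S_g_tens:
  assumes "\<sigma> \<in> cauchy_seqs G" "\<tau> \<in> cauchy_seqs G"
  shows "dst S (cauchy_class G (\<lambda>n. g (tens G m (\<sigma> n)))) (cauchy_class G (\<lambda>n. g (tens G k (\<tau> n)))) =
    rep_dist S (m, cauchy_class G \<sigma>) (k, cauchy_class G \<tau>)"
proof -
  have "(\<lambda>n. dst G (g (tens G m (\<sigma> n))) (g (tens G k (\<tau> n)))) \<longlonglongrightarrow>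
      rep_dist S (m, cauchy_class G \<sigma>) (k, cauchy_class G \<tau>)"
    using G.tendsto_rep_dist[OF assms] assms G.cauchy_seqs_in by (simp add: dst_g_tens S_def)
  then show ?thesis
    using assms unfolding S_def by (simp add: G.dst_cauchy_class g_tens_cauchy G.lim_dist_eqI)
qed

text \<open>As for \<open>g\<close>, the isometry on representatives, here
  \<open>dst_S_g_tens\<close>, forces all admissible values to coincide.\<close>

lemma s_tens_cauchy_class:
  assumes "\<sigma> \<in> cauchy_seqs G"
  shows "s (tens S m (cauchy_class G \<sigma>)) = cauchy_class G (\<lambda>n. g (tens G m (\<sigma> n)))"
  unfolding s_def
proof (rule the_equality)
  have "(m, cauchy_class G \<sigma>) \<in> tens S m (cauchy_class G \<sigma>)" "\<sigma> \<in> cauchy_class G \<sigma>"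
    using assms by (simp_all add: S.in_tens_iff cauchy_class_in_S G.in_cauchy_class_iff)
  then show "\<exists>k P \<tau>. (k, P) \<in> tens S m (cauchy_class G \<sigma>) \<and> \<tau> \<in> P \<and>
      cauchy_class G (\<lambda>n. g (tens G m (\<sigma> n))) = cauchy_class G (\<lambda>n. g (tens G k (\<tau> n)))"
    by blast
next
  fix Q
  assume "\<exists>k P \<tau>. (k, P) \<in> tens S m (cauchy_class G \<sigma>) \<and> \<tau> \<in> P \<and>
      Q = cauchy_class G (\<lambda>n. g (tens G k (\<tau> n)))"
  then obtain k P \<tau> where P: "(k, P) \<in> tens S m (cauchy_class G \<sigma>)" "\<tau> \<in> P"
    and Q: "Q = cauchy_class G (\<lambda>n. g (tens G k (\<tau> n)))"
    by blast
  have P_in: "P \<in> pts S" and P_eq: "tens S k P = tens S m (cauchy_class G \<sigma>)"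
    using P(1) assms by (simp_all add: S.in_tens_iff cauchy_class_in_S)
  obtain \<tau>' where "\<tau>' \<in> cauchy_seqs G" "P = cauchy_class G \<tau>'"
    using P_in by (rule pts_S_E)
  then have \<tau>: "\<tau> \<in> cauchy_seqs G" "P = cauchy_class G \<tau>"
    using P(2) G.in_cauchy_class_iff by auto
  then have "dst S Q (cauchy_class G (\<lambda>n. g (tens G m (\<sigma> n)))) = 0"
    using P_in P_eq assms unfolding Q by (simp add: dst_S_g_tens S.tens_eq_iff cauchy_class_in_S)
  then show "Q = cauchy_class G (\<lambda>n. g (tens G m (\<sigma> n)))"
    using Q assms \<tau> by (simp add: S.dst_zero cauchy_class_in_S g_tens_cauchy)
qed

lemma s_tens_in: "P \<in> pts S \<Longrightarrow> s (tens S m P) \<in> pts S"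
  by (auto elim!: pts_S_E simp: s_tens_cauchy_class cauchy_class_in_S g_tens_cauchy)

lemma dst_s_tens:
  "P \<in> pts S \<Longrightarrow> Q \<in> pts S \<Longrightarrow> dst S (s (tens S m P)) (s (tens S k Q)) = rep_dist S (m, P) (k, Q)"
  by (auto elim!: pts_S_E simp: s_tens_cauchy_class dst_S_g_tens)

lemma finite_mon: "finite (UNIV :: mon set)"
  by (rule finite_subset[of _ "{Ma, Mb, Mc}"]) (use mon.exhaust in auto)

text \<open>A Cauchy sequence in \<open>G\<close> lies infinitely often in one of the three copies of \<open>G\<close>.\<close>

lemma s_tens_surj:
  assumes "P \<in> pts S"
  obtains m Q where "Q \<in> pts S" "P = s (tens S m Q)"
proof -
  obtain \<sigma> where \<sigma>: "\<sigma> \<in> cauchy_seqs G" "P = cauchy_class G \<sigma>"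
    using assms by (rule pts_S_E)
  have "\<exists>m Q. Q \<in> pts G \<and> \<sigma> n = g (tens G m Q)" for n
    using g_tens_surj[OF G.cauchy_seqs_in[OF \<sigma>(1)]] by metis
  then obtain \<mu> \<tau> where \<tau>: "\<And>n. \<tau> n \<in> pts G" "\<And>n. \<sigma> n = g (tens G (\<mu> n) (\<tau> n))"
    by metis
  have "finite (range \<mu>)"
    using finite_mon by (rule finite_subset[rotated]) simp
  then obtain m where "infinite (\<mu> -` {m})"
    using inf_img_fin_domE[of \<mu> UNIV] by (metis infinite_UNIV_nat vimage_def Collect_cong Int_UNIV_right)
  then obtain r :: "nat \<Rightarrow> nat" where r: "strict_mono r" "\<And>n. \<mu> (r n) = m"
    using infinite_enumerate[of "\<mu> -` {m}"] by auto
  note sub = G.subseq_cauchy[OF \<sigma>(1) r(1)]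
  have \<sigma>r: "\<sigma> \<circ> r = (\<lambda>n. g (tens G m ((\<tau> \<circ> r) n)))"
    using \<tau>(2) r(2) by auto
  \<comment> \<open>Along \<open>r\<close> all letters equal \<open>m\<close>, so distances between
    terms of \<open>\<tau>\<close> are twice those between terms of \<open>\<sigma>\<close>.\<close>
  have "\<tau> \<circ> r \<in> cauchy_seqs G"
    unfolding G.cauchy_seqs_iff
  proof (intro conjI allI impI)
    fix n show "(\<tau> \<circ> r) n \<in> pts G"
      using \<tau>(1) by simp
  next
    fix \<epsilon> :: real
    assume "\<epsilon> > 0"
    then have "\<epsilon> / 2 > 0" by simp
    then obtain N where "\<forall>n n'. N \<le> n \<longrightarrow> N \<le> n' \<longrightarrow> dst G ((\<sigma> \<circ> r) n) ((\<sigma> \<circ> r) n') < \<epsilon> / 2"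
      using sub(1) unfolding G.cauchy_seqs_iff by meson
    then show "\<exists>N. \<forall>n n'. N \<le> n \<longrightarrow> N \<le> n' \<longrightarrow> dst G ((\<tau> \<circ> r) n) ((\<tau> \<circ> r) n') < \<epsilon>"
      using \<tau>(1) unfolding \<sigma>r by (auto simp: dst_g_tens G.rep_dist_same)
  qed
  then have "cauchy_class G (\<tau> \<circ> r) \<in> pts S" "P = s (tens S m (cauchy_class G (\<tau> \<circ> r)))"
    using \<sigma>(2) sub(2) by (simp_all add: cauchy_class_in_S s_tens_cauchy_class \<sigma>r)
  then show thesis
    using that by blast
qed

lemma inj_on_s: "inj_on s (pts (MT S))"
proof (rule inj_onI)
  fix C D
  assume C: "C \<in> pts (MT S)" and D: "D \<in> pts (MT S)" and eq: "s C = s D"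
  obtain m P k Q where PQ: "P \<in> pts S" "C = tens S m P" "Q \<in> pts S" "D = tens S k Q"
    using C D by (meson S.pts_MT_E)
  then have "dst S (s (tens S m P)) (s (tens S k Q)) = 0"
    using eq by (simp add: S.dst_self s_tens_in)
  then show "C = D"
    using PQ by (simp add: dst_s_tens S.tens_eq_iff)
qed

lemma \<psi>_s: "C \<in> pts (MT S) \<Longrightarrow> \<psi> (s C) = C"
  unfolding \<psi>_def by (rule inv_into_f_f[OF inj_on_s])

lemma s_\<psi>:
  assumes "P \<in> pts S"
  shows "s (\<psi> P) = P"
proof -
  obtain m Q where "Q \<in> pts S" "P = s (tens S m Q)"
    using assms by (rule s_tens_surj)
  then show ?thesis
    by (simp add: \<psi>_s)
qed

section \<open>Addresses and their limits\<close>

text \<open>Indexing the corners by letters turns the three corner equations into one: the corner of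
  \<open>MT X\<close> with index \<open>m\<close> is \<open>m \<otimes> vertex X m\<close>.\<close>

fun vertex :: "('a, 'z) tripointed_scheme \<Rightarrow> mon \<Rightarrow> 'a" where
  "vertex X Ma = topp X"
| "vertex X Mb = leftp X"
| "vertex X Mc = rightp X"

lemma tri_hom_vertex: "tri_hom X Y f \<Longrightarrow> f (vertex X m) = vertex Y m"
  by (cases m) (auto simp: tri_hom_def)

lemma (in tripointed_metric) vertex_in [simp]: "vertex X m \<in> pts X"
  by (cases m) auto

lemma (in tripointed_metric) vertex_MT: "vertex (MT X) m = tens X m (vertex X m)"
  by (cases m) (simp_all add: corners_MT)

text \<open>No gluing involves \<open>a \<otimes> T\<close>, \<open>b \<otimes> L\<close> or
  \<open>c \<otimes> R\<close>, so a corner of \<open>MT X\<close> has a single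
  representative.\<close>

lemma (in tripointed_metric) tens_vertex_D:
  assumes "tens X m (vertex X m) = tens X k y" "y \<in> pts X"
  shows "k = m \<and> y = vertex X m"
proof -
  have "topp X \<noteq> leftp X" "topp X \<noteq> rightp X" "leftp X \<noteq> rightp X"
    using dst_corners by (metis zero_neq_one)+
  then show ?thesis
    using tens_eq_D[OF vertex_in assms(2,1)] by (cases m) (auto elim!: glue.cases)
qed

lemma g_tens_vertex: "g (tens G m (vertex G m)) = vertex G m"
  by (cases m) (simp_all add: g_tens_corners)

lemma word_in: "word ms i \<in> pts (iter (length ms))"
proof (induction ms)
  case Nil
  then show ?case by (cases i) (simp_all add: three_def)
next
  case (Cons m ms)
  then show ?case by (simp add: pts_transport_MT)
qed

lemma \<theta>_in: "\<theta> \<mu> n \<in> pts G"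
  unfolding \<theta>_def using word_in[of "map \<mu> [1..<Suc n]"] by (intro colim_class_in) (simp del: upt_Suc)

lemma \<theta>_0: "\<theta> \<mu> 0 = vertex G (\<mu> 0)"
  by (cases "\<mu> 0") (simp_all add: \<theta>_def G_def)

text \<open>The shifted address has \<open>\<mu> 1\<close> at index \<open>0\<close>. For
  \<open>n = 0\<close> this is exactly the letter that determines the final corner, so the recursion
  holds from the start.\<close>

lemma \<theta>_Suc: "\<theta> \<mu> (Suc n) = g (tens G (\<mu> 1) (\<theta> (\<mu> \<circ> Suc) n))"
proof -
  have upt: "[1..<Suc (Suc n)] = 1 # map Suc [1..<Suc n]"
    by (simp add: map_Suc_upt upt_conv_Cons del: upt_Suc)
  have "word (map (\<mu> \<circ> Suc) [1..<Suc n]) i \<in> pts (iter n)" for i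
    using word_in[of "map (\<mu> \<circ> Suc) [1..<Suc n]"] by (simp del: upt_Suc)
  then show ?thesis
    unfolding \<theta>_def upt by (simp add: g_tens_colim_class graft_def del: upt_Suc)
qed

text \<open>The two points share their first \<open>n\<close> letters, each of which halves a
  distance at most \<open>1\<close>. Removing a letter shifts the address, so the induction runs
  over all \<open>\<mu>\<close>.\<close>

lemma dst_\<theta>_le: "dst G (\<theta> \<mu> n) (\<theta> \<mu> (n + k)) \<le> (1 / 2) ^ n"
proof (induction n arbitrary: \<mu>)
  case 0
  then show ?case by (simp add: G.dst_le_1 \<theta>_in)
next
  case (Suc n)
  then show ?case
    by (simp add: \<theta>_Suc dst_g_tens \<theta>_in G.rep_dist_same)
qed

lemma \<theta>_cauchy: "\<theta> \<mu> \<in> cauchy_seqs G"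
  unfolding G.cauchy_seqs_iff
proof (intro conjI allI impI \<theta>_in)
  fix \<epsilon> :: real
  assume "\<epsilon> > 0"
  then obtain N where N: "(1 / 2) ^ N < \<epsilon> / 2"
    using real_arch_pow_inv[of "\<epsilon> / 2" "1 / 2"] by auto
  have "dst G (\<theta> \<mu> n) (\<theta> \<mu> n') < \<epsilon>" if "N \<le> n" "N \<le> n'" for n n'
    using that dst_\<theta>_le[of \<mu> N "n - N"] dst_\<theta>_le[of \<mu> N "n' - N"] N
      G.dst_triangle[of "\<theta> \<mu> n" "\<theta> \<mu> N" "\<theta> \<mu> n'"] G.dst_commute[of "\<theta> \<mu> n" "\<theta> \<mu> N"]
    by (simp add: \<theta>_in)
  then show "\<exists>N. \<forall>n n'. N \<le> n \<longrightarrow> N \<le> n' \<longrightarrow> dst G (\<theta> \<mu> n) (\<theta> \<mu> n') < \<epsilon>"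
    by blast
qed

definition \<theta>_lim :: "(nat \<Rightarrow> mon) \<Rightarrow> (nat \<Rightarrow> (nat \<times> univ) set) set" where
  "\<theta>_lim \<mu> = cauchy_class G (\<theta> \<mu>)"

lemma \<theta>_lim_in: "\<theta>_lim \<mu> \<in> pts S"
  unfolding \<theta>_lim_def by (rule cauchy_class_in_S[OF \<theta>_cauchy])

lemma limitin_\<theta>: "limitin (mtop S) (\<lambda>k. incl G (\<theta> \<mu> k)) (\<theta>_lim \<mu>) sequentially"
proof -
  have "incl G (\<theta> \<mu> k) \<in> pts S" for k
    unfolding incl_def by (rule cauchy_class_in_S[OF G.const_cauchy[OF \<theta>_in]])
  then show ?thesis
    using G.tendsto_incl[OF \<theta>_cauchy[of \<mu>], folded S_def \<theta>_lim_def] \<theta>_lim_in[of \<mu>]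
    by (simp add: Metric_space.limitin_metric_dist_null[OF S.Metric_space_dst])
qed

lemma mediating_eq: "mediating \<mu> x = \<theta>_lim (\<mu> x)"
  unfolding mediating_def
  using limitin_\<theta> Metric_space.limitin_metric_unique[OF S.Metric_space_dst _ limitin_\<theta>]
  by (intro the_equality) auto

text \<open>Dropping index \<open>0\<close> does not change the limit, and all remaining terms begin
  with the letter \<open>\<mu> 1\<close>.\<close>

lemma \<theta>_lim_Suc: "\<theta>_lim \<mu> = s (tens S (\<mu> 1) (\<theta>_lim (\<mu> \<circ> Suc)))"
proof -
  have "\<theta>_lim \<mu> = cauchy_class G (\<theta> \<mu> \<circ> Suc)"
    unfolding \<theta>_lim_def by (rule G.subseq_cauchy(2)[symmetric, OF \<theta>_cauchy]) (simp add: strict_mono_def)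
  moreover have "\<theta> \<mu> \<circ> Suc = (\<lambda>n. g (tens G (\<mu> 1) (\<theta> (\<mu> \<circ> Suc) n)))"
    by (auto simp: \<theta>_Suc)
  ultimately show ?thesis
    by (simp add: \<theta>_lim_def s_tens_cauchy_class \<theta>_cauchy)
qed

text \<open>Prefixing \<open>m\<close> fixes the corner of index \<open>m\<close>. Since
  \<open>\<mu> 0\<close> is arbitrary, the claim begins at index \<open>1\<close>.\<close>

lemma \<theta>_const:
  assumes "\<And>n. \<mu> (Suc n) = m"
  shows "\<theta> \<mu> (Suc n) = vertex G m"
  using assms
proof (induction n arbitrary: \<mu>)
  case 0
  then show ?case by (simp add: \<theta>_Suc \<theta>_0 g_tens_vertex)
next
  case (Suc n)
  then have "\<theta> (\<mu> \<circ> Suc) (Suc n) = vertex G m"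
    by (intro Suc.IH) simp
  then show ?case
    using Suc.prems by (simp add: \<theta>_Suc[of \<mu> "Suc n"] g_tens_vertex)
qed

lemma \<theta>_lim_const:
  assumes "\<And>n. \<mu> (Suc n) = m"
  shows "\<theta>_lim \<mu> = vertex S m"
proof -
  have "\<theta>_lim \<mu> = cauchy_class G (\<theta> \<mu> \<circ> Suc)"
    unfolding \<theta>_lim_def by (rule G.subseq_cauchy(2)[symmetric, OF \<theta>_cauchy]) (simp add: strict_mono_def)
  moreover have "\<theta> \<mu> \<circ> Suc = (\<lambda>_. vertex G m)"
    using \<theta>_const[of \<mu> m] assms by auto
  moreover have "cauchy_class G (\<lambda>_. vertex G m) = vertex S m"
    by (cases m) (simp_all add: S_def G.corners_completion)
  ultimately show ?thesis by simp
qed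

lemma unravels_Suc:
  assumes "unravels X e x \<mu> \<xi>"
  shows "unravels X e (\<xi> 1) (\<mu> \<circ> Suc) (\<xi> \<circ> Suc)" "e x = tens X (\<mu> 1) (\<xi> 1)" "\<xi> 1 \<in> pts X"
  using assms by (auto simp: unravels_def)

section \<open>Independence of the choice of representatives\<close>

context tripointed_metric
begin

text \<open>At a corner the choice is forced: \<open>e\<close> maps it to a corner of
  \<open>MT X\<close>, whose only representative is the same corner under its own letter, so the
  address is constant.\<close>

lemma \<theta>_lim_vertex:
  assumes "tri_hom X (MT X) e" "unravels X e (vertex X m) \<mu> \<xi>"
  shows "\<theta>_lim \<mu> = vertex S m"
proof (rule \<theta>_lim_const)
  have step: "\<mu> (Suc n) = m \<and> \<xi> (Suc n) = vertex X m" if "\<xi> n = vertex X m" for n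
  proof (rule tens_vertex_D)
    have "e (\<xi> n) = tens X m (vertex X m)"
      using that tri_hom_vertex[OF assms(1), of m] by (simp add: vertex_MT)
    then show "tens X m (vertex X m) = tens X (\<mu> (Suc n)) (\<xi> (Suc n))" "\<xi> (Suc n) \<in> pts X"
      using assms(2) by (auto simp: unravels_def)
  qed
  have "\<xi> n = vertex X m" for n
    by (induction n) (use assms(2) step in \<open>auto simp: unravels_def\<close>)
  then show "\<mu> (Suc n) = m" for n
    using step by blast
qed

lemma dst_\<theta>_lim_le:
  assumes "tri_hom X (MT X) e"
  shows "unravels X e x \<mu> \<xi> \<Longrightarrow> unravels X e x \<mu>' \<xi>' \<Longrightarrow> dst S (\<theta>_lim \<mu>) (\<theta>_lim \<mu>') \<le> (1 / 2) ^ n"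
proof (induction n arbitrary: x \<mu> \<xi> \<mu>' \<xi>')
  case 0
  then show ?case by (simp add: S.dst_le_1 \<theta>_lim_in)
next
  case (Suc n)
  note u = unravels_Suc[OF Suc.prems(1)] and u' = unravels_Suc[OF Suc.prems(2)]
  \<comment> \<open>Glued points are corners, so their limits are the corresponding corners of
    \<open>S\<close> for every choice, and these are glued in \<open>MT S\<close> in the same
    way.\<close>
  have glued: "tens S k (\<theta>_lim (\<nu> \<circ> Suc)) = tens S l (\<theta>_lim (\<nu>' \<circ> Suc))"
    if "glue X (k, y) (l, z)" "unravels X e y (\<nu> \<circ> Suc) \<zeta>" "unravels X e z (\<nu>' \<circ> Suc) \<zeta>'"
    for k l y z \<nu> \<nu>' \<zeta> \<zeta>'
    using that(1)
  proof cases
    case 1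
    then show ?thesis
      using \<theta>_lim_vertex[OF assms, of Ma] \<theta>_lim_vertex[OF assms, of Mb] that S.tens_glue by simp
  next
    case 2
    then show ?thesis
      using \<theta>_lim_vertex[OF assms, of Ma] \<theta>_lim_vertex[OF assms, of Mc] that S.tens_glue by simp
  next
    case 3
    then show ?thesis
      using \<theta>_lim_vertex[OF assms, of Mb] \<theta>_lim_vertex[OF assms, of Mc] that S.tens_glue by simp
  qed
  have "(\<mu> 1, \<xi> 1) = (\<mu>' 1, \<xi>' 1) \<or> glue X (\<mu> 1, \<xi> 1) (\<mu>' 1, \<xi>' 1) \<or> glue X (\<mu>' 1, \<xi>' 1) (\<mu> 1, \<xi> 1)"
    using u u' by (intro tens_eq_D) auto
  then consider "\<mu> 1 = \<mu>' 1" "\<xi> 1 = \<xi>' 1"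
    | "tens S (\<mu> 1) (\<theta>_lim (\<mu> \<circ> Suc)) = tens S (\<mu>' 1) (\<theta>_lim (\<mu>' \<circ> Suc))"
    using glued[OF _ u(1) u'(1)] glued[OF _ u'(1) u(1)] by auto
  then show ?case
  proof cases
    case 1
    then have "dst S (\<theta>_lim (\<mu> \<circ> Suc)) (\<theta>_lim (\<mu>' \<circ> Suc)) \<le> (1 / 2) ^ n"
      using Suc.IH u(1) u'(1) by simp
    then show ?thesis
      using 1 by (simp add: \<theta>_lim_Suc[of \<mu>] \<theta>_lim_Suc[of \<mu>'] dst_s_tens \<theta>_lim_in S.rep_dist_same)
  next
    case 2
    then have "\<theta>_lim \<mu> = \<theta>_lim \<mu>'"
      by (simp add: \<theta>_lim_Suc[of \<mu>] \<theta>_lim_Suc[of \<mu>'])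
    then show ?thesis
      by (simp add: S.dst_self \<theta>_lim_in)
  qed
qed

end

section \<open>Uniqueness and continuity of coalgebra morphisms\<close>

lemma le_half_powers_imp_eq:
  assumes "P \<in> pts S" "Q \<in> pts S" "\<And>n. dst S P Q \<le> (1 / 2) ^ n"
  shows "P = Q"
proof -
  have "(\<lambda>n. (1 / 2 :: real) ^ n) \<longlonglongrightarrow> 0"
    by (rule LIMSEQ_power_zero) simp
  then have "dst S P Q \<le> 0"
    using assms(3) by (intro LIMSEQ_le_const) auto
  then show ?thesis
    using S.dst_zero[OF assms(1,2)] S.dst_nonneg[of P Q] by linarith
qed

text \<open>One representation \<open>e x = m \<otimes> y\<close> serves both morphisms, so the
  distance at \<open>x\<close> is half of that at \<open>y\<close>.\<close>

lemma (in tripointed_metric) dst_coalgebra_morphisms_le: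
  assumes e: "tri_hom X (MT X) e"
    and f: "tri_hom X S f" "\<And>x. x \<in> pts X \<Longrightarrow> f x = s (MT_map S f (e x))"
    and h: "tri_hom X S h" "\<And>x. x \<in> pts X \<Longrightarrow> h x = s (MT_map S h (e x))"
    and x: "x \<in> pts X"
  shows "dst S (h x) (f x) \<le> (1 / 2) ^ n"
  using x
proof (induction n arbitrary: x)
  case 0
  have "f x \<in> pts S" "h x \<in> pts S"
    using f(1) h(1) 0 by (auto simp: tri_hom_def)
  then show ?case by (simp add: S.dst_le_1)
next
  case (Suc n)
  have "e x \<in> pts (MT X)"
    using e Suc.prems by (auto simp: tri_hom_def)
  then obtain m y where y: "y \<in> pts X" "e x = tens X m y"
    by (rule pts_MT_E)
  have "f y \<in> pts S" "h y \<in> pts S"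
    using f(1) h(1) y by (auto simp: tri_hom_def)
  then show ?case
    using Suc.IH[OF y(1)] f(2)[OF Suc.prems] h(2)[OF Suc.prems] y
      MT_map_tens[OF tripointed_metric_axioms S.tripointed_metric_axioms f(1)]
      MT_map_tens[OF tripointed_metric_axioms S.tripointed_metric_axioms h(1)]
    by (simp add: dst_s_tens S.rep_dist_same)
qed

text \<open>A route between two copies either passes their common gluing point, which costs at least
  the distance from \<open>x\<close> to that corner, or goes around and costs at least
  \<open>1\<close>.\<close>

lemma (in tripointed_metric) gluing_vertices:
  assumes "m \<noteq> k"
  obtains i j where "tens X m (vertex X i) = tens X k (vertex X j)"
    "\<And>x y. rep_dist X (m, x) (k, y) \<ge> min (dst X x (vertex X i)) 1 / 2"
proof -
  have le: "min d 1 \<le> d + dst X u v" "min d 1 \<le> dst X u v + d"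
    "min d 1 \<le> dst X u v + 1 + dst X u' v'" for d u v u' v'
    using dst_nonneg[of u v] dst_nonneg[of u' v'] by linarith+
  show thesis
  proof (cases m; cases k)
    assume "m = Ma" "k = Mb"
    then show thesis using that[of Mb Ma] le tens_glue by (simp add: dst_commute)
  next
    assume "m = Mb" "k = Ma"
    then show thesis using that[of Ma Mb] le tens_glue by (simp add: dst_commute)
  next
    assume "m = Ma" "k = Mc"
    then show thesis using that[of Mc Ma] le tens_glue by (simp add: dst_commute)
  next
    assume "m = Mc" "k = Ma"
    then show thesis using that[of Ma Mc] le tens_glue by (simp add: dst_commute)
  next
    assume "m = Mb" "k = Mc"
    then show thesis using that[of Mc Mb] le tens_glue by (simp add: dst_commute)
  next
    assume "m = Mc" "k = Mb"
    then show thesis using that[of Mb Mc] le tens_glue by (simp add: dst_commute)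
  qed (use assms in auto)
qed

text \<open>A point close to \<open>C\<close> in another copy of \<open>X\<close> forces \<open>C\<close> to be the gluing point of the two copies.\<close>

lemma (in tripointed_metric) near_same_copy:
  assumes "C \<in> pts (MT X)"
  obtains \<epsilon> where "\<epsilon> > 0"
    "\<And>D. D \<in> pts (MT X) \<Longrightarrow> dst (MT X) C D < \<epsilon> \<Longrightarrow>
      \<exists>m x y. x \<in> pts X \<and> y \<in> pts X \<and> C = tens X m x \<and> D = tens X m y"
proof -
  obtain m x where x: "x \<in> pts X" "C = tens X m x"
    using assms by (rule pts_MT_E)
  \<comment> \<open>The radius will be half of \<open>Min E\<close>. A closer point in another copy
    makes the distance from \<open>x\<close> to the gluing corner smaller than every positive one of
    its kind, hence \<open>0\<close>. The element \<open>1\<close> keeps \<open>E\<close> nonempty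
    and absorbs the \<open>1\<close> in the bound of \<open>gluing_vertices\<close>.\<close>
  define E where "E = insert 1 {dst X x (vertex X i) |i. dst X x (vertex X i) > 0}"
  have "E \<subseteq> insert 1 (range (\<lambda>i. dst X x (vertex X i)))"
    by (auto simp: E_def)
  then have fin: "finite E"
    using finite_mon finite_subset by blast
  have "Min E > 0"
    using fin by (auto simp: E_def)
  moreover have "\<exists>k x' y. x' \<in> pts X \<and> y \<in> pts X \<and> C = tens X k x' \<and> D = tens X k y"
    if D: "D \<in> pts (MT X)" "dst (MT X) C D < Min E / 2" for D
  proof -
    obtain k y where y: "y \<in> pts X" "D = tens X k y"
      using D(1) by (rule pts_MT_E)
    show ?thesis
    proof (cases "m = k")
      case True
      then show ?thesis using x y by blast
    next
      case False
      then obtain i j where ij: "tens X m (vertex X i) = tens X k (vertex X j)"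
        "rep_dist X (m, x) (k, y) \<ge> min (dst X x (vertex X i)) 1 / 2"
        using gluing_vertices by metis
      have "min (dst X x (vertex X i)) 1 < Min E"
        using ij(2) D(2) x y by (simp add: dst_MT)
      moreover have "Min E \<le> 1"
        using fin by (simp add: E_def)
      ultimately have lt: "dst X x (vertex X i) < Min E"
        by linarith
      have "dst X x (vertex X i) \<notin> E"
        using lt fin Min_le not_le by blast
      then have "dst X x (vertex X i) = 0"
        using dst_nonneg[of x "vertex X i"] by (auto simp: E_def less_le)
      then have "C = tens X k (vertex X j)"
        using ij(1) x by (simp add: dst_zero)
      then show ?thesis
        using y vertex_in by blast
    qed
  qed
  ultimately show thesis
    using that[of "Min E / 2"] by auto
qed

lemma (in tripointed_metric) continuous_coalgebra_morphism:
  assumes e: "tri_hom X (MT X) e" "continuous_map (mtop X) (mtop (MT X)) e"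
    and f: "tri_hom X S f" "\<And>x. x \<in> pts X \<Longrightarrow> f x = s (MT_map S f (e x))"
  shows "continuous_map (mtop X) (mtop S) f"
proof -
  interpret MT: tripointed_metric "MT X" by (rule tripointed_metric_MT)
  have f_in: "f x \<in> pts S" if "x \<in> pts X" for x
    using f(1) that by (auto simp: tri_hom_def)
  have e_in: "e x \<in> pts (MT X)" if "x \<in> pts X" for x
    using e(1) that by (auto simp: tri_hom_def)
  have e_cont: "\<forall>x\<in>pts X. \<forall>\<epsilon>>0. \<exists>\<delta>>0. \<forall>y. y \<in> pts X \<and> dst X x y < \<delta> \<longrightarrow> dst (MT X) (e x) (e y) < \<epsilon>"
    using Metric_space.metric_continuous_map[OF Metric_space_dst MT.Metric_space_dst] e(2) by simp
  \<comment> \<open>The induction covers all points at once, since the step at \<open>x\<close> uses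
    the bound at the points \<open>z\<close> of the representatives of \<open>e x\<close>.\<close>
  have near: "\<exists>\<delta>>0. \<forall>y\<in>pts X. dst X x y < \<delta> \<longrightarrow> dst S (f x) (f y) \<le> (1 / 2) ^ n"
    if "x \<in> pts X" for n x
    using that
  proof (induction n arbitrary: x)
    case 0
    then show ?case by (auto simp: S.dst_le_1 f_in intro!: exI[of _ 1])
  next
    case (Suc n)
    have "finite (e x)"
      using e_in[OF Suc.prems] unfolding pts_MT by (rule finite_tens_class)
    have "\<forall>z\<in>pts X. \<exists>\<delta>>0. \<forall>y\<in>pts X. dst X z y < \<delta> \<longrightarrow> dst S (f z) (f y) \<le> (1 / 2) ^ n"
      using Suc.IH by blast
    then obtain \<delta> where \<delta>: "\<And>z. z \<in> pts X \<Longrightarrow> \<delta> z > 0"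
      "\<And>z y. z \<in> pts X \<Longrightarrow> y \<in> pts X \<Longrightarrow> dst X z y < \<delta> z \<Longrightarrow> dst S (f z) (f y) \<le> (1 / 2) ^ n"
      unfolding bchoice_iff by blast
    \<comment> \<open>Which representative of \<open>e x\<close> shares a copy with
      \<open>e y\<close> depends on \<open>y\<close>, so \<open>\<eta>\<close> must serve all of the
      finitely many.\<close>
    define \<eta> where "\<eta> = Min (insert 1 ((\<lambda>p. \<delta> (snd p)) ` e x))"
    obtain m' z' where "z' \<in> pts X" "e x = tens X m' z'"
      using e_in[OF Suc.prems] by (rule pts_MT_E)
    then have e_x: "z \<in> pts X" if "(m, z) \<in> e x" for m z
      using that by (simp add: in_tens_iff)
    have "\<eta> > 0"
      using \<open>finite (e x)\<close> e_x \<delta>(1) by (auto simp: \<eta>_def)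
    have \<eta>_le: "\<eta> \<le> \<delta> z" if "z \<in> pts X" "e x = tens X m z" for m z
    proof -
      have "(m, z) \<in> e x"
        using that by (simp add: in_tens_iff)
      then show ?thesis
        using \<open>finite (e x)\<close> unfolding \<eta>_def by (intro Min_le) force+
    qed
    obtain \<epsilon> where \<epsilon>: "\<epsilon> > 0" "\<And>D. D \<in> pts (MT X) \<Longrightarrow> dst (MT X) (e x) D < \<epsilon> \<Longrightarrow>
      \<exists>m z y. z \<in> pts X \<and> y \<in> pts X \<and> e x = tens X m z \<and> D = tens X m y"
      using near_same_copy[OF e_in[OF Suc.prems]] by blast
    \<comment> \<open>The bound \<open>\<epsilon>\<close> provides a common copy; there distances
      are halved, so \<open>\<eta> / 2\<close> leaves the points \<open>z\<close> and
      \<open>w\<close> closer than \<open>\<eta>\<close>.\<close>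
    have "min \<epsilon> (\<eta> / 2) > 0"
      using \<open>\<eta> > 0\<close> \<open>\<epsilon> > 0\<close> by simp
    then obtain \<delta>' where \<delta>': "\<delta>' > 0"
      "\<And>y. y \<in> pts X \<Longrightarrow> dst X x y < \<delta>' \<Longrightarrow> dst (MT X) (e x) (e y) < min \<epsilon> (\<eta> / 2)"
      using e_cont Suc.prems by meson
    have "dst S (f x) (f y) \<le> (1 / 2) ^ Suc n" if y: "y \<in> pts X" "dst X x y < \<delta>'" for y
    proof -
      have close: "dst (MT X) (e x) (e y) < min \<epsilon> (\<eta> / 2)"
        using \<delta>'(2) y by blast
      then obtain m z w where zw: "z \<in> pts X" "w \<in> pts X" "e x = tens X m z" "e y = tens X m w"
        using \<epsilon>(2)[OF e_in[OF y(1)]] by auto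
      then have "dst X z w < \<delta> z"
        using close \<eta>_le[of z m] by (simp add: dst_MT_same)
      then have "dst S (f z) (f w) \<le> (1 / 2) ^ n"
        using zw \<delta>(2) by blast
      then show ?thesis
        using f(2)[OF Suc.prems] f(2)[OF y(1)] zw f_in
          MT_map_tens[OF tripointed_metric_axioms S.tripointed_metric_axioms f(1)]
        by (simp add: dst_s_tens S.rep_dist_same)
    qed
    then show ?case
      using \<delta>'(1) by blast
  qed
  have "\<exists>\<delta>>0. \<forall>y. y \<in> pts X \<and> dst X x y < \<delta> \<longrightarrow> dst S (f x) (f y) < \<epsilon>"
    if "x \<in> pts X" "\<epsilon> > 0" for x \<epsilon>
  proof -
    obtain n where "(1 / 2) ^ n < \<epsilon>"
      using real_arch_pow_inv[OF \<open>\<epsilon> > 0\<close>, of "1 / 2"] by auto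
    then show ?thesis
      using near[OF that(1), of n] order_le_less_trans by blast
  qed
  then show ?thesis
    unfolding Metric_space.metric_continuous_map[OF Metric_space_dst S.Metric_space_dst]
    using f_in by blast
qed

section \<open>Existence, uniqueness and continuity of the mediating morphism\<close>

theorem proposition2:
  fixes X :: "'a trimetric"
    and e :: "'a \<Rightarrow> (mon \<times> 'a) set"
    and \<mu> :: "'a \<Rightarrow> nat \<Rightarrow> mon"
    and \<xi> :: "'a \<Rightarrow> nat \<Rightarrow> 'a"
  assumes "tripointed_metric_space X"
    and "tri_hom X (MT X) e"
    and "continuous_map (mtop X) (mtop (MT X)) e"
    and "\<And>x. x \<in> pts X \<Longrightarrow> unravels X e x (\<mu> x) (\<xi> x)"
  shows "(\<forall>x\<in>pts X. limitin (mtop S) (\<lambda>k. incl G (\<theta> (\<mu> x) k)) (mediating \<mu> x) sequentially) \<and>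
         coalgebra_morphism_to_S X e (mediating \<mu>) \<and>
         (\<forall>h. coalgebra_morphism_to_S X e h \<longrightarrow> (\<forall>x\<in>pts X. h x = mediating \<mu> x)) \<and>
         continuous_map (mtop X) (mtop S) (mediating \<mu>)"
proof -
  interpret X: tripointed_metric X
    using assms(1) by unfold_locales
  let ?f = "mediating \<mu>"
  note hom = assms(2) and unravels = assms(4)
  have f_vertex: "?f (vertex X m) = vertex S m" for m
    unfolding mediating_eq by (rule X.\<theta>_lim_vertex[OF hom unravels]) simp
  have f_hom: "tri_hom X S ?f"
    using f_vertex[of Ma] f_vertex[of Mb] f_vertex[of Mc]
    by (auto simp: tri_hom_def mediating_eq \<theta>_lim_in)
  note map_f = MT_map_tens[OF X.tripointed_metric_axioms S.tripointed_metric_axioms f_hom]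
  have f_eq: "?f x = s (MT_map S ?f (e x))" if x: "x \<in> pts X" for x
  proof -
    note u = unravels_Suc[OF unravels[OF x]]
    \<comment> \<open>The tail of the address chosen for \<open>x\<close> may differ from the
      address chosen for \<open>\<xi> x 1\<close>, but both unravel this same point and therefore
      have equal limits.\<close>
    have "\<theta>_lim (\<mu> x \<circ> Suc) = ?f (\<xi> x 1)"
      unfolding mediating_eq
      by (rule le_half_powers_imp_eq[OF \<theta>_lim_in \<theta>_lim_in])
         (rule X.dst_\<theta>_lim_le[OF hom u(1) unravels[OF u(3)]])
    then show ?thesis
      using u(2,3) map_f by (simp add: mediating_eq[of \<mu> x] \<theta>_lim_Suc[of "\<mu> x"])
  qed
  have map_in: "MT_map S h (e x) \<in> pts (MT S)" if h: "tri_hom X S h" and x: "x \<in> pts X" for h x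
  proof -
    have "e x \<in> pts (MT X)"
      using hom x by (auto simp: tri_hom_def)
    then obtain m y where y: "y \<in> pts X" "e x = tens X m y"
      by (rule X.pts_MT_E)
    moreover have "h y \<in> pts S"
      using h y(1) by (auto simp: tri_hom_def)
    ultimately show ?thesis
      using MT_map_tens[OF X.tripointed_metric_axioms S.tripointed_metric_axioms h] by simp
  qed
  have morphism: "coalgebra_morphism_to_S X e ?f"
    using f_hom f_eq map_in[OF f_hom] \<psi>_s by (simp add: coalgebra_morphism_to_S_def)
  have unique: "h x = ?f x" if h: "coalgebra_morphism_to_S X e h" and x: "x \<in> pts X" for h x
  proof -
    have h_hom: "tri_hom X S h" and "\<And>y. y \<in> pts X \<Longrightarrow> MT_map S h (e y) = \<psi> (h y)"
      using h by (auto simp: coalgebra_morphism_to_S_def)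
    \<comment> \<open>Applying \<open>s\<close> to the coalgebra equation removes
      \<open>\<psi>\<close> and gives the form in which morphisms are compared.\<close>
    then have h_eq: "h y = s (MT_map S h (e y))" if "y \<in> pts X" for y
      using that s_\<psi> by (auto simp: tri_hom_def)
    show ?thesis
    proof (rule le_half_powers_imp_eq)
      show "h x \<in> pts S" "?f x \<in> pts S"
        using h_hom f_hom x by (auto simp: tri_hom_def)
    qed (rule X.dst_coalgebra_morphisms_le[OF hom f_hom f_eq h_hom h_eq x])
  qed
  show ?thesis
  proof (intro conjI)
    show "\<forall>x\<in>pts X. limitin (mtop S) (\<lambda>k. incl G (\<theta> (\<mu> x) k)) (?f x) sequentially"
      by (simp add: mediating_eq limitin_\<theta>)
    show "\<forall>h. coalgebra_morphism_to_S X e h \<longrightarrow> (\<forall>x\<in>pts X. h x = ?f x)"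
      using unique by blast
    show "continuous_map (mtop X) (mtop S) ?f"
      using f_hom f_eq by (rule X.continuous_coalgebra_morphism[OF hom assms(3)])
  qed (rule morphism)
qed

end
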